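(* If $M$ is a totally geodesic almost complex surface in the nearly Kähler manifold $(SL(2,\mathbb{R})\times SL(2,\mathbb{R}),g,J)$, then either (1) $P$ maps the tangent space of $M$ into the normal space of $M$ and the Gaussian curvature $K$ of $M$ is $-\tfrac43$; or (2) $P$ preserves the tangent space of $M$ (and therefore also the normal space) and the Gaussian curvature of $M$ is $0$.
   Context: For trace-zero real $2\times2$ matrices put $\langle\alpha,\beta\rangle=\tfrac12\operatorname{Trace}(\alpha\beta)$. One has $T_ASL(2,\mathbb{R})=\{A\alpha:\operatorname{Trace}\alpha=0\}$, so tangent vectors of $SL(2,\mathbb{R})\times SL(2,\mathbb{R})$ at $(A,B)$ are the pairs $(A\alpha,B\beta)$ with $\alpha,\beta$ real $2\times 2$ matrices of trace $0$. The pseudo-Riemannian metric $g$, the almost complex structure $J$ and the almost product structure $P$ are $$g((A\alpha,B\beta),(A\gamma,B\delta))=\tfrac23\big(\langle\alpha,\gamma\rangle+\langle\beta,\delta\rangle\big)-\tfrac13\big(\langle\beta,\gamma\rangle+\langle\alpha,\delta\rangle\big),$$ $$J(A\alpha,B\beta)=\tfrac{1}{\sqrt3}\big(A(\alpha-2\beta),B(2\alpha-\beta)\big),\qquad P(A\alpha,B\beta)=(A\beta,B\alpha).$$ With these, $(SL(2,\mathbb{R})\times SL(2,\mathbb{R}),g,J)$ is a nearly Kähler manifold. An almost complex surface is an immersed 2-dimensional connected submanifold $M$ whose tangent spaces are $J$-invariant; it is always assumed regular, i.e. the metric induced by $g$ is non-degenerate (hence positive or negative definite). Normal spaces, second fundamental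 form $h$, and Gaussian curvature (of the induced metric) are taken with respect to $g$. Totally geodesic means $h=0$. *)

theory Defs
  imports "HOL-Analysis.Analysis"
begin

section \<open>Smooth maps\<close>

primrec times_differentiable_on ::
  "nat \<Rightarrow> 'a::real_normed_vector set \<Rightarrow> ('a \<Rightarrow> 'b::real_normed_vector) \<Rightarrow> bool" where
  "times_differentiable_on 0 U f \<longleftrightarrow> continuous_on U f"
| "times_differentiable_on (Suc k) U f \<longleftrightarrow>
     (\<forall>x\<in>U. f differentiable (at x)) \<and>
     (\<forall>v. times_differentiable_on k U (\<lambda>x. frechet_derivative f (at x) v))"

text \<open>Class \<open>C\<^sup>\<infinity>\<close>; only used for open \<open>U\<close>.\<close>

definition smooth_on :: "'a::real_normed_vector set \<Rightarrow> ('a \<Rightarrow> 'b::real_normed_vector) \<Rightarrow> bool" where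
  "smooth_on U f \<longleftrightarrow> (\<forall>k. times_differentiable_on k U f)"


section \<open>The nearly Kaehler structure on \<open>SL(2,\<real>) \<times> SL(2,\<real>)\<close>\<close>

type_synonym mat2 = "real^2^2"
type_synonym mat22 = "mat2 \<times> mat2"

definition SL2 :: "mat2 set" where
  "SL2 = {A. det A = 1}"

abbreviation SLSL :: "mat22 set" where
  "SLSL \<equiv> SL2 \<times> SL2"

text \<open>Tangent vectors are elements of the ambient space \<open>mat22\<close>.\<close>

definition tangent_SLSL :: "mat22 \<Rightarrow> mat22 set" where
  "tangent_SLSL p = {(fst p ** \<alpha>, snd p ** \<beta>) |\<alpha> \<beta>. trace \<alpha> = 0 \<and> trace \<beta> = 0}"

text \<open>\<open>left_triv (A, B) (A\<alpha>, B\<beta>) = (\<alpha>, \<beta>)\<close> for invertible \<open>A\<close> and \<open>B\<close>.\<close>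

definition left_triv :: "mat22 \<Rightarrow> mat22 \<Rightarrow> mat22" where
  "left_triv p V = (matrix_inv (fst p) ** fst V, matrix_inv (snd p) ** snd V)"

definition ip :: "mat2 \<Rightarrow> mat2 \<Rightarrow> real" where
  "ip \<alpha> \<beta> = trace (\<alpha> ** \<beta>) / 2"

definition nk_metric :: "mat22 \<Rightarrow> mat22 \<Rightarrow> mat22 \<Rightarrow> real" where
  "nk_metric p V W =
     (let (\<alpha>, \<beta>) = left_triv p V; (\<gamma>, \<delta>) = left_triv p W
      in 2/3 * (ip \<alpha> \<gamma> + ip \<beta> \<delta>) - 1/3 * (ip \<beta> \<gamma> + ip \<alpha> \<delta>))"

definition J_map :: "mat22 \<Rightarrow> mat22 \<Rightarrow> mat22" where
  "J_map p V =
     (let (\<alpha>, \<beta>) = left_triv p V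
      in (1 / sqrt 3) *\<^sub>R (fst p ** (\<alpha> - 2 *\<^sub>R \<beta>), snd p ** (2 *\<^sub>R \<alpha> - \<beta>)))"

definition P_map :: "mat22 \<Rightarrow> mat22 \<Rightarrow> mat22" where
  "P_map p V = (let (\<alpha>, \<beta>) = left_triv p V in (fst p ** \<beta>, snd p ** \<alpha>))"


section \<open>The Levi-Civita connection\<close>

text \<open>Fields are defined and smooth near \<open>SLSL\<close>, but need to be tangent only along it.\<close>

definition vector_field :: "(mat22 \<Rightarrow> mat22) \<Rightarrow> bool" where
  "vector_field X \<longleftrightarrow>
     (\<exists>W. open W \<and> SLSL \<subseteq> W \<and> smooth_on W X) \<and> (\<forall>p\<in>SLSL. X p \<in> tangent_SLSL p)"

text \<open>
  On a submanifold of a vector space every affine connection differs from the ambient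
  directional derivative by a tensorial term \<open>\<Gamma>\<close>:
  \<open>(\<nabla>\<^bsub>v\<^esub> Y)(p) = dY\<^bsub>p\<^esub>(v) + \<Gamma>\<^bsub>p\<^esub>(v, Y(p))\<close>.
  Only the values of \<open>\<Gamma>\<^bsub>p\<^esub>\<close> on tangent vectors at points \<open>p\<close> of \<open>SLSL\<close> matter.
\<close>

definition covd :: "(mat22 \<Rightarrow> mat22 \<Rightarrow> mat22 \<Rightarrow> mat22) \<Rightarrow> (mat22 \<Rightarrow> mat22) \<Rightarrow> (mat22 \<Rightarrow> mat22)
    \<Rightarrow> mat22 \<Rightarrow> mat22" where
  "covd \<Gamma> X Y p = frechet_derivative Y (at p) (X p) + \<Gamma> p (X p) (Y p)"

definition lie_bracket :: "(mat22 \<Rightarrow> mat22) \<Rightarrow> (mat22 \<Rightarrow> mat22) \<Rightarrow> mat22 \<Rightarrow> mat22" where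
  "lie_bracket X Y p = frechet_derivative Y (at p) (X p) - frechet_derivative X (at p) (Y p)"

text \<open>
  The conditions say in turn that \<open>\<nabla>\<close> is a connection on the tangent bundle, is torsion-free,
  and is compatible with the metric.
\<close>

definition is_levi_civita :: "(mat22 \<Rightarrow> mat22 \<Rightarrow> mat22 \<Rightarrow> mat22) \<Rightarrow> bool" where
  "is_levi_civita \<Gamma> \<longleftrightarrow>
     (\<forall>p\<in>SLSL. bilinear (\<Gamma> p)) \<and>
     (\<forall>X Y. vector_field X \<longrightarrow> vector_field Y \<longrightarrow>
        (\<forall>p\<in>SLSL. covd \<Gamma> X Y p \<in> tangent_SLSL p \<and>
                  covd \<Gamma> X Y p - covd \<Gamma> Y X p = lie_bracket X Y p)) \<and>
     (\<forall>X Y Z. vector_field X \<longrightarrow> vector_field Y \<longrightarrow> vector_field Z \<longrightarrow>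
        (\<forall>p\<in>SLSL. frechet_derivative (\<lambda>q. nk_metric q (Y q) (Z q)) (at p) (X p) =
                  nk_metric p (covd \<Gamma> X Y p) (Z p) + nk_metric p (Y p) (covd \<Gamma> X Z p)))"

text \<open>
  Such a \<open>\<Gamma>\<close> exists, and is unique on tangent vectors at points of \<open>SLSL\<close>; there
  the choice below is therefore determined.
\<close>

definition levi_civita :: "mat22 \<Rightarrow> mat22 \<Rightarrow> mat22 \<Rightarrow> mat22" where
  "levi_civita = (SOME \<Gamma>. is_levi_civita \<Gamma>)"

section \<open>Parametrized surfaces\<close>

text \<open>
  In this section \<open>\<phi>\<close> is a smooth immersion of an open subset of \<open>\<real>\<^sup>2\<close> into \<open>SLSL\<close> and \<open>u\<close>
  a parameter value.
\<close>

definition tangent_plane :: "(real^2 \<Rightarrow> mat22) \<Rightarrow> real^2 \<Rightarrow> mat22 set" where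
  "tangent_plane \<phi> u = range (frechet_derivative \<phi> (at u))"

definition normal_subspace :: "(real^2 \<Rightarrow> mat22) \<Rightarrow> real^2 \<Rightarrow> mat22 set" where
  "normal_subspace \<phi> u =
     {N \<in> tangent_SLSL (\<phi> u). \<forall>V\<in>tangent_plane \<phi> u. nk_metric (\<phi> u) N V = 0}"

text \<open>Well defined if the induced metric is non-degenerate at \<open>u\<close>.\<close>

definition normal_part :: "(real^2 \<Rightarrow> mat22) \<Rightarrow> real^2 \<Rightarrow> mat22 \<Rightarrow> mat22" where
  "normal_part \<phi> u V = (THE N. N \<in> normal_subspace \<phi> u \<and> V - N \<in> tangent_plane \<phi> u)"

text \<open>The derivative, with respect to the Levi-Civita connection, of a field \<open>Y\<close> along \<open>\<phi>\<close>.\<close>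

definition covd_along :: "(real^2 \<Rightarrow> mat22) \<Rightarrow> real^2 \<Rightarrow> (real^2 \<Rightarrow> mat22) \<Rightarrow> real^2 \<Rightarrow> mat22" where
  "covd_along \<phi> a Y u =
     frechet_derivative Y (at u) a + levi_civita (\<phi> u) (frechet_derivative \<phi> (at u) a) (Y u)"

text \<open>
  The value \<open>h(d\<phi>(a), d\<phi>(b))\<close>, computed as the normal part of \<open>\<nabla>\<^bsub>d\<phi>(a)\<^esub> d\<phi>(b)\<close>, where
  \<open>b\<close> is extended to a constant vector field on the parameter domain.
\<close>

definition second_fundamental_form ::
  "(real^2 \<Rightarrow> mat22) \<Rightarrow> real^2 \<Rightarrow> real^2 \<Rightarrow> real^2 \<Rightarrow> mat22" where
  "second_fundamental_form \<phi> u a b =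
     normal_part \<phi> u (covd_along \<phi> a (\<lambda>u'. frechet_derivative \<phi> (at u') b) u)"

definition partial_deriv :: "2 \<Rightarrow> (real^2 \<Rightarrow> 'b::real_normed_vector) \<Rightarrow> real^2 \<Rightarrow> 'b" where
  "partial_deriv i f u = frechet_derivative f (at u) (axis i 1)"

definition induced_metric :: "(real^2 \<Rightarrow> mat22) \<Rightarrow> real^2 \<Rightarrow> real^2^2" where
  "induced_metric \<phi> u = (\<chi> i j. nk_metric (\<phi> u) (partial_deriv i \<phi> u) (partial_deriv j \<phi> u))"

text \<open>For a metric \<open>G\<close> in coordinates, \<open>\<nabla>\<^bsub>\<partial>i\<^esub> \<partial>j = (\<Sum>k. christoffel G k i j \<cdot> \<partial>k)\<close>.\<close>

definition christoffel :: "(real^2 \<Rightarrow> real^2^2) \<Rightarrow> 2 \<Rightarrow> 2 \<Rightarrow> 2 \<Rightarrow> real^2 \<Rightarrow> real" where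
  "christoffel G k i j u =
     (\<Sum>l\<in>UNIV. matrix_inv (G u) $ k $ l *
        (partial_deriv i (\<lambda>u'. G u' $ j $ l) u + partial_deriv j (\<lambda>u'. G u' $ i $ l) u
          - partial_deriv l (\<lambda>u'. G u' $ i $ j) u)) / 2"

text \<open>\<open>R(\<partial>i, \<partial>j)\<partial>k = (\<Sum>l. riemann G l k i j \<cdot> \<partial>l)\<close>
  with \<open>R(X, Y) = [\<nabla>\<^bsub>X\<^esub>, \<nabla>\<^bsub>Y\<^esub>] - \<nabla>\<^bsub>[X, Y]\<^esub>\<close>.\<close>

definition riemann :: "(real^2 \<Rightarrow> real^2^2) \<Rightarrow> 2 \<Rightarrow> 2 \<Rightarrow> 2 \<Rightarrow> 2 \<Rightarrow> real^2 \<Rightarrow> real" where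
  "riemann G l k i j u =
     partial_deriv i (christoffel G l j k) u - partial_deriv j (christoffel G l i k) u
     + (\<Sum>m\<in>UNIV. christoffel G l i m u * christoffel G m j k u
                 - christoffel G l j m u * christoffel G m i k u)"

text \<open>\<open>K = g(R(\<partial>1, \<partial>2)\<partial>2, \<partial>1) / (g(\<partial>1, \<partial>1) g(\<partial>2, \<partial>2) - g(\<partial>1, \<partial>2)\<^sup>2)\<close>, for either
  sign of the metric.\<close>

definition gaussian_curvature :: "(real^2 \<Rightarrow> mat22) \<Rightarrow> real^2 \<Rightarrow> real" where
  "gaussian_curvature \<phi> u =
     (let G = induced_metric \<phi>
      in (\<Sum>l\<in>UNIV. G u $ l $ 1 * riemann G l 2 1 2 u) / det (G u))"


section \<open>Almost complex surfaces\<close>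

text \<open>
  An atlas of a surface is a set of pairs \<open>(U, x)\<close> of an open subset \<open>U\<close> of \<open>\<real>\<^sup>2\<close> and a
  parametrization \<open>x\<close> (the inverse of a chart) defined on \<open>U\<close>.
\<close>

type_synonym 'm atlas = "((real^2) set \<times> (real^2 \<Rightarrow> 'm)) set"

definition smooth_surface :: "'m topology \<Rightarrow> 'm atlas \<Rightarrow> bool" where
  "smooth_surface M \<A> \<longleftrightarrow>
     Hausdorff_space M \<and> second_countable M \<and>
     topspace M = (\<Union>(U, x)\<in>\<A>. x ` U) \<and>
     (\<forall>(U, x)\<in>\<A>. open U \<and> openin M (x ` U) \<and>
        homeomorphic_map (top_of_set U) (subtopology M (x ` U)) x) \<and>
     (\<forall>(U, x)\<in>\<A>. \<forall>(V, y)\<in>\<A>. smooth_on {u \<in> U. x u \<in> y ` V} (inv_into V y \<circ> x))"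

text \<open>
  The map \<open>F\<close> exhibits \<open>M\<close> as an immersed submanifold. It is not required to be injective.
\<close>

definition immersed_surface :: "'m topology \<Rightarrow> 'm atlas \<Rightarrow> ('m \<Rightarrow> mat22) \<Rightarrow> bool" where
  "immersed_surface M \<A> F \<longleftrightarrow>
     smooth_surface M \<A> \<and> F ` topspace M \<subseteq> SLSL \<and>
     (\<forall>(U, x)\<in>\<A>. smooth_on U (F \<circ> x) \<and>
        (\<forall>u\<in>U. inj (frechet_derivative (F \<circ> x) (at u))))"

definition almost_complex_surface :: "'m topology \<Rightarrow> 'm atlas \<Rightarrow> ('m \<Rightarrow> mat22) \<Rightarrow> bool" where
  "almost_complex_surface M \<A> F \<longleftrightarrow>
     immersed_surface M \<A> F \<and> connected_space M \<and>
     (\<forall>(U, x)\<in>\<A>. \<forall>u\<in>U.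
        J_map (F (x u)) ` tangent_plane (F \<circ> x) u \<subseteq> tangent_plane (F \<circ> x) u \<and>
        (\<forall>V\<in>tangent_plane (F \<circ> x) u.
           (\<forall>W\<in>tangent_plane (F \<circ> x) u. nk_metric (F (x u)) V W = 0) \<longrightarrow> V = 0))"

definition totally_geodesic :: "'m atlas \<Rightarrow> ('m \<Rightarrow> mat22) \<Rightarrow> bool" where
  "totally_geodesic \<A> F \<longleftrightarrow>
     (\<forall>(U, x)\<in>\<A>. \<forall>u\<in>U. \<forall>a b. second_fundamental_form (F \<circ> x) u a b = 0)"

end

theory Submission
  imports Defs
begin

text \<open>
  The idea is to transport everything to the Lie algebra.  A parametrization \<open>\<phi> = (A, B)\<close> of the
  surface yields the two fields \<open>e i = (A\<inverse> \<partial>\<^sub>i A, B\<inverse> \<partial>\<^sub>i B)\<close> of pairs of trace-free matrices, and the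
  metric, \<open>J\<close>, \<open>P\<close> and the Levi-Civita connection become constant tensors \<open>g0\<close>, \<open>rotJ / sqrt 3\<close>,
  \<open>prod.swap\<close> and \<open>omega\<close> on the space of such pairs; the connection is the one given by the Koszul
  formula (\<open>levi_civita_SLSL\<close>).  Total geodesy says that \<open>D i j = \<partial>\<^sub>i (e j) + omega (e i) (e j)\<close> is a
  combination of \<open>e 1\<close> and \<open>e 2\<close>, and the coefficients are then the Christoffel symbols of the
  induced metric.  Differentiating once more and using \<open>\<partial>\<^sub>1 \<partial>\<^sub>2 = \<partial>\<^sub>2 \<partial>\<^sub>1\<close> gives the equations of Gauss
  and Codazzi together (\<open>Gauss_equation\<close>): the ambient curvature \<open>Omega (e 1) (e 2)\<close> maps the
  tangent plane into itself, and does so by the intrinsic curvature.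

  What remains is algebra in one tangent plane.  It is spanned by \<open>X = (\<alpha>, \<beta>)\<close> and
  \<open>rotJ X = (\<alpha> - 2\<beta>, 2\<alpha> - \<beta>)\<close>, and with \<open>w = [\<alpha>, \<beta>]\<close> the curvature is
  \<open>Omega X (rotJ X) X = - 2/3 ([\<alpha>, w], [\<beta>, w])\<close>.  For trace-free \<open>2 \<times> 2\<close> matrices the double brackets
  expand into \<open>\<alpha>\<close> and \<open>\<beta>\<close>, so that the value lies in the plane only if either \<open>w = 0\<close> or
  \<open>\<langle>\<alpha>, \<alpha>\<rangle> = \<langle>\<beta>, \<beta>\<rangle> = 2 \<langle>\<alpha>, \<beta>\<rangle>\<close> (\<open>curvature_dichotomy\<close>).  If \<open>w = 0\<close>, then \<open>\<alpha>\<close> and \<open>\<beta>\<close> are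
  multiples of one matrix \<open>\<nu>\<close>, the plane consists of all pairs of multiples of \<open>\<nu>\<close>, hence is preserved
  by \<open>P\<close>, and the curvature vanishes.  In the other case \<open>P\<close> maps the plane into its orthogonal
  complement, and the curvature is \<open>- 4/3\<close>.

  A nondegenerate plane cannot be of both kinds, and each kind occurs on an open set, because the
  other kind is given by equations.  As \<open>M\<close> is connected, only one kind occurs.
\<close>

section \<open>Calculus of smooth maps\<close>

lemma times_differentiable_on_cong:
  assumes "open U" "\<And>x. x \<in> U \<Longrightarrow> f x = g x" "times_differentiable_on k U f"
  shows "times_differentiable_on k U g"
  using assms(2,3)
proof (induction k arbitrary: f g)
  case 0
  then show ?case using continuous_on_cong by force
next
  case (Suc k)
  have d: "(g has_derivative frechet_derivative f (at x)) (at x)" if "x \<in> U" for x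
    using Suc.prems that assms(1)
    by (metis frechet_derivative_works has_derivative_transform_within_open times_differentiable_on.simps(2))
  then have eq: "frechet_derivative f (at x) = frechet_derivative g (at x)" if "x \<in> U" for x
    using frechet_derivative_at that by blast
  have "times_differentiable_on k U (\<lambda>x. frechet_derivative g (at x) v)" for v
    by (rule Suc.IH[of "\<lambda>x. frechet_derivative f (at x) v"]) (use eq Suc.prems in auto)
  then show ?case using differentiableI[OF d] by simp
qed

lemma times_differentiable_on_const: "times_differentiable_on k U (\<lambda>x. c)"
  by (induction k arbitrary: c) auto

lemma times_differentiable_on_add:
  assumes "open U" "times_differentiable_on k U f" "times_differentiable_on k U g"
  shows "times_differentiable_on k U (\<lambda>x. f x + g x)"
  using assms(2,3)
proof (induction k arbitrary: f g)
  case 0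
  then show ?case by (simp add: continuous_on_add)
next
  case (Suc k)
  have d: "((\<lambda>x. f x + g x) has_derivative
      (\<lambda>v. frechet_derivative f (at x) v + frechet_derivative g (at x) v)) (at x)" if "x \<in> U" for x
    using Suc.prems that by (auto intro!: has_derivative_add simp: frechet_derivative_works[symmetric])
  have "times_differentiable_on k U (\<lambda>x. frechet_derivative (\<lambda>x. f x + g x) (at x) v)" for v
    by (rule times_differentiable_on_cong[OF assms(1) _ Suc.IH[of
          "\<lambda>x. frechet_derivative f (at x) v" "\<lambda>x. frechet_derivative g (at x) v"]])
      (use frechet_derivative_at[OF d] Suc.prems in \<open>auto simp: fun_eq_iff\<close>)
  then show ?case using differentiableI[OF d] by simp
qed

lemma times_differentiable_on_Suc_imp:
  assumes "times_differentiable_on (Suc k) U f"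
  shows "times_differentiable_on k U f"
  using assms
proof (induction k arbitrary: f)
  case 0
  then show ?case
    by (auto intro!: continuous_at_imp_continuous_on differentiable_imp_continuous_within)
next
  case (Suc k)
  then show ?case by (metis times_differentiable_on.simps(2))
qed

lemma times_differentiable_on_bilinear:
  assumes "bounded_bilinear h" "open U"
    and "times_differentiable_on k U f" "times_differentiable_on k U g"
  shows "times_differentiable_on k U (\<lambda>x. h (f x) (g x))"
  using assms(3,4)
proof (induction k arbitrary: f g)
  case 0
  then show ?case by (simp add: bounded_bilinear.continuous_on[OF assms(1)])
next
  case (Suc k)
  have d: "((\<lambda>x. h (f x) (g x)) has_derivative
      (\<lambda>v. h (f x) (frechet_derivative g (at x) v) + h (frechet_derivative f (at x) v) (g x))) (at x)"
    if "x \<in> U" for x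
    using Suc.prems that
    by (auto intro!: bounded_bilinear.FDERIV[OF assms(1)] simp: frechet_derivative_works[symmetric])
  have fg: "times_differentiable_on k U f" "times_differentiable_on k U g"
    using Suc.prems times_differentiable_on_Suc_imp by blast+
  have "times_differentiable_on k U (\<lambda>x. frechet_derivative (\<lambda>x. h (f x) (g x)) (at x) v)" for v
    by (rule times_differentiable_on_cong[OF assms(2) _ times_differentiable_on_add[OF assms(2)
        Suc.IH[of f "\<lambda>x. frechet_derivative g (at x) v"]
        Suc.IH[of "\<lambda>x. frechet_derivative f (at x) v" g]]])
      (use frechet_derivative_at[OF d] Suc.prems fg in \<open>auto simp: fun_eq_iff\<close>)
  then show ?case using differentiableI[OF d] by simp
qed

lemma times_differentiable_on_linear:
  assumes "bounded_linear L" "open U" "times_differentiable_on k U f"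
  shows "times_differentiable_on k U (\<lambda>x. L (f x))"
  using assms(3)
proof (induction k arbitrary: f)
  case 0
  then show ?case by (simp add: bounded_linear.continuous_on[OF assms(1)])
next
  case (Suc k)
  have d: "((\<lambda>x. L (f x)) has_derivative (\<lambda>v. L (frechet_derivative f (at x) v))) (at x)"
    if "x \<in> U" for x
    using Suc.prems that
    by (auto intro!: bounded_linear.has_derivative[OF assms(1)] simp: frechet_derivative_works[symmetric])
  have "times_differentiable_on k U (\<lambda>x. frechet_derivative (\<lambda>x. L (f x)) (at x) v)" for v
    by (rule times_differentiable_on_cong[OF assms(2) _ Suc.IH[of "\<lambda>x. frechet_derivative f (at x) v"]])
      (use frechet_derivative_at[OF d] Suc.prems in \<open>auto simp: fun_eq_iff\<close>)
  then show ?case using differentiableI[OF d] by simp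
qed

lemma times_differentiable_on_ident: "times_differentiable_on k U (\<lambda>x. x)"
  by (cases k) (auto simp: times_differentiable_on_const)

lemma smooth_on_bilinear:
  assumes "bounded_bilinear h" "open U" "smooth_on U f" "smooth_on U g"
  shows "smooth_on U (\<lambda>x. h (f x) (g x))"
  using assms times_differentiable_on_bilinear unfolding smooth_on_def by blast

lemma smooth_on_linear:
  assumes "bounded_linear L" "open U" "smooth_on U f"
  shows "smooth_on U (\<lambda>x. L (f x))"
  using assms times_differentiable_on_linear unfolding smooth_on_def by blast

lemma smooth_on_imp_differentiable:
  assumes "smooth_on U f" "x \<in> U"
  shows "f differentiable (at x)"
  using assms unfolding smooth_on_def by (metis times_differentiable_on.simps(2))

lemma smooth_on_frechet_derivative:
  assumes "smooth_on U f"
  shows "smooth_on U (\<lambda>x. frechet_derivative f (at x) v)"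
  using assms unfolding smooth_on_def by (metis times_differentiable_on.simps(2))

lemma smooth_on_partial_deriv:
  assumes "smooth_on U f"
  shows "smooth_on U (partial_deriv i f)"
  using smooth_on_frechet_derivative[OF assms] unfolding partial_deriv_def[abs_def] .

lemma smooth_on_imp_continuous_on:
  assumes "smooth_on U f"
  shows "continuous_on U f"
  using assms unfolding smooth_on_def by (metis times_differentiable_on.simps(1))

text \<open>
  The second difference quotient is symmetric in \<open>a\<close> and \<open>b\<close>, whereas its limit is an iterated
  derivative; by symmetry it is then also the one in the other order.  The limit is computed with
  the mean value theorem in direction \<open>a\<close>, followed by the differentiability of \<open>\<lambda>y. G y a\<close>
  at the single point \<open>x\<close>.
\<close>

lemma second_difference_quotient_tendsto:
  fixes g :: "'a::real_normed_vector \<Rightarrow> real"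
  assumes "open U" "x \<in> U"
    and g: "\<And>y. y \<in> U \<Longrightarrow> (g has_derivative G y) (at y)"
    and L: "((\<lambda>y. G y a) has_derivative L) (at x)"
  shows "((\<lambda>t. (g (x + t *\<^sub>R a + t *\<^sub>R b) - g (x + t *\<^sub>R a) - g (x + t *\<^sub>R b) + g x) / t\<^sup>2) \<longlongrightarrow> L b)
    (at_right 0)"
proof (rule tendstoI)
  fix e :: real assume "e > 0"
  define N where "N = norm a + norm b + 1"
  have "N > 0" unfolding N_def by (smt (verit) norm_ge_zero)
  define e' where "e' = e / (4 * N)"
  have "e' > 0" unfolding e'_def using \<open>e > 0\<close> \<open>N > 0\<close> by simp
  obtain d1 where d1: "d1 > 0"
    and L': "\<And>y. norm (y - x) < d1 \<Longrightarrow> norm (G y a - G x a - L (y - x)) \<le> e' * norm (y - x)"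
    using L \<open>e' > 0\<close> unfolding has_derivative_at_alt by blast
  obtain d2 where d2: "d2 > 0" "ball x d2 \<subseteq> U"
    using assms(1,2) openE by blast
  have linL: "linear L" using L has_derivative_linear by blast
  define d where "d = min d1 d2 / N"
  have "d > 0" unfolding d_def using d1 d2 \<open>N > 0\<close> by simp
  have "dist ((g (x + t *\<^sub>R a + t *\<^sub>R b) - g (x + t *\<^sub>R a) - g (x + t *\<^sub>R b) + g x) / t\<^sup>2) (L b) < e"
    if t: "0 < t" "t < d" for t
  proof -
    have tN: "t * N < min d1 d2"
      using t \<open>N > 0\<close> unfolding d_def by (simp add: pos_less_divide_eq)
    have nrm: "norm (s *\<^sub>R t *\<^sub>R a + r *\<^sub>R t *\<^sub>R b) \<le> t * N" if "0 \<le> s" "s \<le> 1" "0 \<le> r" "r \<le> 1" for s r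
    proof -
      have "norm (s *\<^sub>R t *\<^sub>R a + r *\<^sub>R t *\<^sub>R b) \<le> s * (t * norm a) + r * (t * norm b)"
        using norm_triangle_ineq[of "s *\<^sub>R t *\<^sub>R a" "r *\<^sub>R t *\<^sub>R b"] that t by simp
      also have "\<dots> \<le> 1 * (t * norm a) + 1 * (t * norm b)"
        using that t by (intro add_mono mult_right_mono) auto
      also have "\<dots> \<le> t * N" unfolding N_def using t by (simp add: algebra_simps)
      finally show ?thesis .
    qed
    have inU: "x + s *\<^sub>R t *\<^sub>R a + r *\<^sub>R t *\<^sub>R b \<in> U" if "0 \<le> s" "s \<le> 1" "0 \<le> r" "r \<le> 1" for s r
    proof -
      have "x + (s *\<^sub>R t *\<^sub>R a + r *\<^sub>R t *\<^sub>R b) \<in> ball x d2"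
        unfolding mem_ball dist_commute[of x] using nrm[OF that] tN by (simp add: dist_norm del: scaleR_scaleR)
      then show ?thesis using d2 by (auto simp: add.assoc)
    qed
    define p where "p s = g (x + s *\<^sub>R t *\<^sub>R a + t *\<^sub>R b) - g (x + s *\<^sub>R t *\<^sub>R a)" for s
    have p': "(p has_derivative (\<lambda>h. G (x + s *\<^sub>R t *\<^sub>R a + t *\<^sub>R b) (h *\<^sub>R t *\<^sub>R a)
        - G (x + s *\<^sub>R t *\<^sub>R a) (h *\<^sub>R t *\<^sub>R a))) (at s)" if "0 \<le> s" "s \<le> 1" for s
      unfolding p_def
      by (intro has_derivative_diff has_derivative_compose[of "\<lambda>s. x + s *\<^sub>R t *\<^sub>R a + t *\<^sub>R b" _ s UNIV g]
          has_derivative_compose[of "\<lambda>s. x + s *\<^sub>R t *\<^sub>R a" _ s UNIV g])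
        (use g inU[of s 1] inU[of s 0] that in \<open>auto intro!: derivative_eq_intros\<close>)
    have linG: "linear (G y)" if "y \<in> U" for y using g[OF that] has_derivative_linear by blast
    obtain s where s: "0 < s" "s < 1" and ps: "p 1 - p 0 = G (x + s *\<^sub>R t *\<^sub>R a + t *\<^sub>R b) ((1 - 0) *\<^sub>R t *\<^sub>R a)
        - G (x + s *\<^sub>R t *\<^sub>R a) ((1 - 0) *\<^sub>R t *\<^sub>R a)"
      using mvt_simple[of 0 1 p, OF _ has_derivative_at_withinI[OF p']] by auto
    let ?y = "x + s *\<^sub>R t *\<^sub>R a + t *\<^sub>R b" and ?z = "x + s *\<^sub>R t *\<^sub>R a"
    have yz: "?y \<in> U" "?z \<in> U" using inU[of s 1] inU[of s 0] s by auto
    have S: "g (x + t *\<^sub>R a + t *\<^sub>R b) - g (x + t *\<^sub>R a) - g (x + t *\<^sub>R b) + g x = t * (G ?y a - G ?z a)"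
      using ps linear_scale[OF linG[OF yz(1)]] linear_scale[OF linG[OF yz(2)]]
      by (simp add: p_def algebra_simps)
    have ny: "norm (?y - x) \<le> t * N" "norm (?z - x) \<le> t * N"
      using nrm[of s 1] nrm[of s 0] s by (auto simp: algebra_simps)
    have "norm (G ?y a - G x a - L (?y - x)) \<le> e' * (t * N)"
      using L'[of ?y] ny tN \<open>e' > 0\<close> by (smt (verit, best) mult_left_mono)
    moreover have "norm (G ?z a - G x a - L (?z - x)) \<le> e' * (t * N)"
      using L'[of ?z] ny tN \<open>e' > 0\<close> by (smt (verit, best) mult_left_mono)
    moreover have "L (?y - x) - L (?z - x) = t * L b"
    proof -
      have "L (?y - x) - L (?z - x) = L ((?y - x) - (?z - x))" by (simp only: linear_diff[OF linL])
      also have "\<dots> = L (t *\<^sub>R b)" by (simp add: algebra_simps)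
      finally show ?thesis by (simp add: linear_scale[OF linL])
    qed
    ultimately have "\<bar>G ?y a - G ?z a - t * L b\<bar> \<le> 2 * (e' * (t * N))" by (simp add: abs_le_iff)
    also have "\<dots> = e / 2 * t" unfolding e'_def using \<open>N > 0\<close> by simp
    finally have est: "\<bar>G ?y a - G ?z a - t * L b\<bar> \<le> e / 2 * t" .
    have "(g (x + t *\<^sub>R a + t *\<^sub>R b) - g (x + t *\<^sub>R a) - g (x + t *\<^sub>R b) + g x) / t\<^sup>2 - L b
        = (G ?y a - G ?z a - t * L b) / t"
      unfolding S using t by (simp add: power2_eq_square field_simps)
    then have "dist ((g (x + t *\<^sub>R a + t *\<^sub>R b) - g (x + t *\<^sub>R a) - g (x + t *\<^sub>R b) + g x) / t\<^sup>2) (L b)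
        = \<bar>G ?y a - G ?z a - t * L b\<bar> / t"
      using t by (simp add: dist_real_def)
    also have "\<dots> \<le> e / 2" using est t by (simp add: pos_divide_le_eq)
    also have "\<dots> < e" using \<open>e > 0\<close> by simp
    finally show ?thesis .
  qed
  then show "\<forall>\<^sub>F t in at_right 0. dist ((g (x + t *\<^sub>R a + t *\<^sub>R b) - g (x + t *\<^sub>R a) - g (x + t *\<^sub>R b) + g x) / t\<^sup>2) (L b) < e"
    unfolding eventually_at_right_field using \<open>d > 0\<close> by blast
qed

lemma frechet_derivative_inner:
  assumes "f differentiable (at x)"
  shows "((\<lambda>x. f x \<bullet> c) has_derivative (\<lambda>v. frechet_derivative f (at x) v \<bullet> c)) (at x)"
  using assms by (intro has_derivative_inner_left) (simp add: frechet_derivative_works)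

lemma mixed_derivatives_commute:
  fixes f :: "'a::real_normed_vector \<Rightarrow> 'b::euclidean_space"
  assumes "open U" "x \<in> U" "smooth_on U f"
  shows "frechet_derivative (\<lambda>y. frechet_derivative f (at y) a) (at x) b
       = frechet_derivative (\<lambda>y. frechet_derivative f (at y) b) (at x) a"
proof (rule euclidean_eqI)
  fix c :: 'b
  have lim: "((\<lambda>t. (f (x + t *\<^sub>R a + t *\<^sub>R b) \<bullet> c - f (x + t *\<^sub>R a) \<bullet> c - f (x + t *\<^sub>R b) \<bullet> c + f x \<bullet> c) / t\<^sup>2)
      \<longlongrightarrow> frechet_derivative (\<lambda>y. frechet_derivative f (at y) a) (at x) b \<bullet> c) (at_right 0)" for a b
    by (rule second_difference_quotient_tendsto[OF assms(1,2) frechet_derivative_inner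
        frechet_derivative_inner])
      (use smooth_on_imp_differentiable[OF assms(3)] assms(2)
        smooth_on_imp_differentiable[OF smooth_on_frechet_derivative[OF assms(3)]] in auto)
  have "((\<lambda>t. (f (x + t *\<^sub>R a + t *\<^sub>R b) \<bullet> c - f (x + t *\<^sub>R a) \<bullet> c - f (x + t *\<^sub>R b) \<bullet> c + f x \<bullet> c) / t\<^sup>2)
      \<longlongrightarrow> frechet_derivative (\<lambda>y. frechet_derivative f (at y) b) (at x) a \<bullet> c) (at_right 0)"
    by (rule Lim_transform_eventually[OF lim[of b a]]) (simp add: algebra_simps)
  then show "frechet_derivative (\<lambda>y. frechet_derivative f (at y) a) (at x) b \<bullet> c
       = frechet_derivative (\<lambda>y. frechet_derivative f (at y) b) (at x) a \<bullet> c"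
    using tendsto_unique[OF _ lim[of a b]] by simp
qed

lemma partial_deriv_commute:
  fixes f :: "real^2 \<Rightarrow> 'b::euclidean_space"
  assumes "open U" "u \<in> U" "smooth_on U f"
  shows "partial_deriv i (partial_deriv j f) u = partial_deriv j (partial_deriv i f) u"
  using mixed_derivatives_commute[OF assms] unfolding partial_deriv_def by blast

lemma differentiable_cong_open:
  assumes "open U" "x \<in> U" "\<And>y. y \<in> U \<Longrightarrow> f y = g y" "f differentiable (at x)"
  shows "g differentiable (at x)"
  using has_derivative_transform_within_open[OF assms(4)[unfolded frechet_derivative_works] assms(1-3)]
  by (rule differentiableI)

lemma differentiable_bilinear:
  assumes "bounded_bilinear h" "f differentiable (at x)" "g differentiable (at x)"
  shows "(\<lambda>x. h (f x) (g x)) differentiable (at x)"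
  using bounded_bilinear.FDERIV[OF assms(1) assms(2,3)[unfolded frechet_derivative_works]]
  by (rule differentiableI)

lemma differentiable_linear:
  assumes "bounded_linear L" "f differentiable (at x)"
  shows "(\<lambda>x. L (f x)) differentiable (at x)"
  using bounded_linear.has_derivative[OF assms(1) assms(2)[unfolded frechet_derivative_works]]
  by (rule differentiableI)

lemma partial_deriv_eqI:
  assumes "(f has_derivative f') (at u)"
  shows "partial_deriv i f u = f' (axis i 1)"
  using frechet_derivative_at[OF assms] unfolding partial_deriv_def by simp

lemma partial_deriv_bilinear:
  assumes "bounded_bilinear h" "f differentiable (at u)" "g differentiable (at u)"
  shows "partial_deriv i (\<lambda>u. h (f u) (g u)) u
       = h (f u) (partial_deriv i g u) + h (partial_deriv i f u) (g u)"
  using partial_deriv_eqI[OF bounded_bilinear.FDERIV[OF assms(1)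
      assms(2)[unfolded frechet_derivative_works] assms(3)[unfolded frechet_derivative_works]]]
  unfolding partial_deriv_def .

lemma partial_deriv_linear:
  assumes "bounded_linear L" "f differentiable (at u)"
  shows "partial_deriv i (\<lambda>u. L (f u)) u = L (partial_deriv i f u)"
  using partial_deriv_eqI[OF bounded_linear.has_derivative[OF assms(1) assms(2)[unfolded frechet_derivative_works]]]
  unfolding partial_deriv_def .

lemma partial_deriv_const: "partial_deriv i (\<lambda>u. c) u = 0"
  using partial_deriv_eqI[OF has_derivative_const] .

lemma partial_deriv_cong_open:
  assumes "open U" "u \<in> U" "\<And>x. x \<in> U \<Longrightarrow> f x = g x" "f differentiable (at u)"
  shows "partial_deriv i f u = partial_deriv i g u"
  using frechet_derivative_transform_within_open[OF assms(4,1,2)] assms(3) unfolding partial_deriv_def by metis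

lemma partial_deriv_add:
  assumes "f differentiable (at u)" "g differentiable (at u)"
  shows "partial_deriv i (\<lambda>u. f u + g u) u = partial_deriv i f u + partial_deriv i g u"
  using partial_deriv_eqI[OF has_derivative_add[OF
      assms(1)[unfolded frechet_derivative_works] assms(2)[unfolded frechet_derivative_works]]]
  unfolding partial_deriv_def .

lemma partial_deriv_diff:
  assumes "f differentiable (at u)" "g differentiable (at u)"
  shows "partial_deriv i (\<lambda>u. f u - g u) u = partial_deriv i f u - partial_deriv i g u"
  using partial_deriv_eqI[OF has_derivative_diff[OF
      assms(1)[unfolded frechet_derivative_works] assms(2)[unfolded frechet_derivative_works]]]
  unfolding partial_deriv_def .

section \<open>The algebra of pairs of matrices\<close>

lemma mat2_eq_iff:
  "(A::mat2) = B \<longleftrightarrow> A$1$1 = B$1$1 \<and> A$1$2 = B$1$2 \<and> A$2$1 = B$2$1 \<and> A$2$2 = B$2$2"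
  by (simp add: vec_eq_iff forall_2)

lemma matrix_mult_2_nth: "((A::mat2) ** B) $ i $ j = A$i$1 * B$1$j + A$i$2 * B$2$j"
  by (simp add: matrix_matrix_mult_def sum_2)

lemma trace_2: "trace (A::mat2) = A$1$1 + A$2$2"
  by (simp add: trace_def sum_2)

text \<open>
  The adjugate agrees with the inverse on \<open>SL2\<close> but is linear, and is therefore much
  easier to differentiate.
\<close>

definition adj2 :: "mat2 \<Rightarrow> mat2" where
  "adj2 A = (\<chi> i j. if i = j then (if i = 1 then A$2$2 else A$1$1) else - A$i$j)"

lemma adj2_nth [simp]:
  "adj2 A $ 1 $ 1 = A$2$2" "adj2 A $ 2 $ 2 = A$1$1" "adj2 A $ 1 $ 2 = - A$1$2" "adj2 A $ 2 $ 1 = - A$2$1"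
  by (simp_all add: adj2_def)

lemmas mat2_simps = mat2_eq_iff matrix_mult_2_nth trace_2 det_2

lemma adj2_mult_self: "adj2 A ** A = det A *\<^sub>R mat 1" "A ** adj2 A = det A *\<^sub>R mat 1"
  by (simp_all add: mat2_simps mat_def)

lemma matrix_mult_bounded_bilinear:
  "bounded_bilinear ((**) :: mat2 \<Rightarrow> mat2 \<Rightarrow> mat2)"
  unfolding bilinear_conv_bounded_bilinear[symmetric] bilinear_def
  by (auto intro!: linearI simp: mat2_simps algebra_simps)

interpretation matrix_mult: bounded_bilinear "(**) :: mat2 \<Rightarrow> mat2 \<Rightarrow> mat2"
  by (rule matrix_mult_bounded_bilinear)

lemma matrix_inv_2:
  assumes "det (A::mat2) \<noteq> 0"
  shows "matrix_inv A = (1 / det A) *\<^sub>R adj2 A"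
  unfolding matrix_inv_def
proof (rule some_equality)
  show *: "A ** ((1 / det A) *\<^sub>R adj2 A) = mat 1 \<and> (1 / det A) *\<^sub>R adj2 A ** A = mat 1"
    using assms adj2_mult_self[of A]
    by (simp add: matrix_mult.scaleR_left matrix_mult.scaleR_right)
  show "B = (1 / det A) *\<^sub>R adj2 A" if "A ** B = mat 1 \<and> B ** A = mat 1" for B
    using that * by (metis matrix_mul_assoc matrix_mul_lid matrix_mul_rid)
qed

definition mmul :: "mat22 \<Rightarrow> mat22 \<Rightarrow> mat22" (infixl "\<odot>" 70) where
  "p \<odot> q = (fst p ** fst q, snd p ** snd q)"

definition unit22 :: mat22 where
  "unit22 = (mat 1, mat 1)"

definition adj22 :: "mat22 \<Rightarrow> mat22" where
  "adj22 p = (adj2 (fst p), adj2 (snd p))"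

definition sl22 :: "mat22 set" where
  "sl22 = {X. trace (fst X) = 0 \<and> trace (snd X) = 0}"

lemma mmul_assoc: "p \<odot> (q \<odot> r) = p \<odot> q \<odot> r"
  by (simp add: mmul_def matrix_mul_assoc)

lemma mmul_unit [simp]: "unit22 \<odot> p = p" "p \<odot> unit22 = p"
  by (simp_all add: mmul_def unit22_def)

lemma bounded_bilinear_mmul: "bounded_bilinear (\<odot>)"
  unfolding bilinear_conv_bounded_bilinear[symmetric] bilinear_def
  by (auto intro!: linearI simp: mmul_def prod_eq_iff mat2_simps algebra_simps)

interpretation mmul: bounded_bilinear "(\<odot>)"
  by (rule bounded_bilinear_mmul)

lemma bounded_linear_adj22: "bounded_linear adj22"
  unfolding linear_conv_bounded_linear[symmetric]
  by (auto intro!: linearI simp: adj22_def prod_eq_iff mat2_simps)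

lemma swap_add: "prod.swap (X + Y :: mat22) = prod.swap X + prod.swap Y"
  and swap_scaleR: "prod.swap (c *\<^sub>R X :: mat22) = c *\<^sub>R prod.swap X"
  by (simp_all add: prod_eq_iff)

lemma adj22_mmul_SLSL:
  assumes "p \<in> SLSL"
  shows "adj22 p \<odot> p = unit22" "p \<odot> adj22 p = unit22"
  using assms by (auto simp: SL2_def mmul_def adj22_def unit22_def adj2_mult_self)

lemma adj22_mmul: "adj22 (p \<odot> q) = adj22 q \<odot> adj22 p"
  by (simp add: adj22_def mmul_def prod_eq_iff mat2_simps)

lemma adj22_sl22: "X \<in> sl22 \<Longrightarrow> adj22 X = - X"
  by (auto simp: adj22_def sl22_def prod_eq_iff mat2_simps)

lemma adj22_cancel [simp]:
  assumes "p \<in> SLSL"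
  shows "adj22 p \<odot> (p \<odot> X) = X" "p \<odot> (adj22 p \<odot> X) = X"
  using adj22_mmul_SLSL[OF assms] by (simp_all add: mmul_assoc)

lemma mmul_cancel:
  assumes "p \<in> SLSL"
  shows "p \<odot> X = p \<odot> Y \<longleftrightarrow> X = Y"
  by (metis adj22_cancel(1) assms)

lemma left_triv_det:
  assumes "det (fst p) \<noteq> 0" "det (snd p) \<noteq> 0"
  shows "left_triv p V = ((1 / det (fst p)) *\<^sub>R (adj2 (fst p) ** fst V),
    (1 / det (snd p)) *\<^sub>R (adj2 (snd p) ** snd V))"
  using assms by (simp add: left_triv_def matrix_inv_2 matrix_mult.scaleR_left)

lemma left_triv_SLSL:
  assumes "p \<in> SLSL"
  shows "left_triv p V = adj22 p \<odot> V"
  using assms by (auto simp: left_triv_det SL2_def adj22_def mmul_def)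

lemma tangent_SLSL_eq:
  "tangent_SLSL p = (\<odot>) p ` sl22"
  by (auto simp: tangent_SLSL_def sl22_def mmul_def image_iff) (metis fst_conv snd_conv)

lemma tangent_SLSL_iff:
  assumes "p \<in> SLSL"
  shows "V \<in> tangent_SLSL p \<longleftrightarrow> adj22 p \<odot> V \<in> sl22"
  unfolding tangent_SLSL_eq image_iff using adj22_cancel[OF assms] by metis

lemma subspace_sl22: "subspace sl22"
  unfolding subspace_def sl22_def
  by (auto simp: trace_add) (simp_all add: trace_2 flip: distrib_left)

definition tr22 :: "mat22 \<Rightarrow> mat22 \<Rightarrow> real" where
  "tr22 X Y = ip (fst X) (fst Y) + ip (snd X) (snd Y)"

text \<open>
  The metric of the left-trivialized tangent space; the term with \<open>prod.swap\<close> collects the two mixed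
  products.
\<close>

definition g0 :: "mat22 \<Rightarrow> mat22 \<Rightarrow> real" where
  "g0 X Y = 2/3 * tr22 X Y - 1/3 * tr22 (prod.swap X) Y"

lemma bounded_bilinear_ip: "bounded_bilinear ip"
  unfolding bilinear_conv_bounded_bilinear[symmetric] bilinear_def
  by (intro conjI allI linearI; simp add: ip_def mat2_simps field_simps)

interpretation ip: bounded_bilinear ip
  by (rule bounded_bilinear_ip)

lemma ip_commute: "ip a b = ip b a"
  by (simp add: ip_def trace_mul_sym[of a b])

lemma bounded_bilinear_tr22: "bounded_bilinear tr22"
  unfolding bilinear_conv_bounded_bilinear[symmetric] bilinear_def
  by (intro conjI allI linearI; simp add: tr22_def ip.add_left ip.add_right ip.scaleR_left ip.scaleR_right algebra_simps)

interpretation tr22: bounded_bilinear tr22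
  by (rule bounded_bilinear_tr22)

lemma bounded_bilinear_g0: "bounded_bilinear g0"
  unfolding bilinear_conv_bounded_bilinear[symmetric] bilinear_def
  by (intro conjI allI linearI; simp add: g0_def swap_add swap_scaleR tr22.add_left tr22.add_right
      tr22.scaleR_left tr22.scaleR_right algebra_simps)

interpretation g0: bounded_bilinear g0
  by (rule bounded_bilinear_g0)

lemma tr22_commute: "tr22 X Y = tr22 Y X"
  using ip_commute by (auto simp: tr22_def)

lemma tr22_swap: "tr22 (prod.swap X) (prod.swap Y) = tr22 X Y"
  by (simp add: tr22_def)

lemma g0_commute: "g0 X Y = g0 Y X"
  using tr22_swap[of "prod.swap X" Y] tr22_commute[of X Y] tr22_commute[of X "prod.swap Y"]
  by (simp add: g0_def)

lemma g0_swap: "g0 (prod.swap X) Y = g0 X (prod.swap Y)"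
  by (simp add: g0_def tr22_def add.commute)

lemma nk_metric_left: 
  "nk_metric p V W = g0 (left_triv p V) (left_triv p W)"
  by (simp add: nk_metric_def g0_def tr22_def case_prod_beta Let_def)

lemma nk_metric_SLSL:
  assumes "p \<in> SLSL"
  shows "nk_metric p V W = g0 (adj22 p \<odot> V) (adj22 p \<odot> W)"
  using assms by (simp add: nk_metric_left left_triv_SLSL)

text \<open>
  Testing against \<open>(c, 0)\<close> and \<open>(0, c)\<close> reduces the claim to the trace form of trace-free matrices,
  where the transpose is a test matrix that yields a sum of squares.
\<close>

lemma sl22_nondegenerate:
  assumes "X \<in> sl22" "\<And>Y. Y \<in> sl22 \<Longrightarrow> g0 X Y = 0"
  shows "X = 0"
proof -
  have T: "ip a c = 0 \<and> ip b c = 0" if "trace c = 0" "X = (a, b)" for a b c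
  proof -
    have "g0 X (c, 0) = 0" "g0 X (0, c) = 0"
      using assms(2)[of "(c, 0)"] assms(2)[of "(0, c)"] that by (auto simp: sl22_def trace_2)
    then show ?thesis using that by (simp add: g0_def tr22_def ip.zero_right)
  qed
  have Z: "a = 0" if "trace a = 0" "\<And>c. trace c = 0 \<Longrightarrow> ip a c = 0" for a
  proof -
    have "trace (transpose a) = 0" using that(1) by (simp add: trace_2 transpose_def)
    then have "ip a (transpose a) = 0" using that(2) by blast
    then have "a$1$1 * a$1$1 + a$1$2 * a$1$2 + (a$2$1 * a$2$1 + a$2$2 * a$2$2) = 0"
      by (simp add: ip_def mat2_simps transpose_def)
    then show ?thesis by (smt (verit) mat2_eq_iff mult_eq_0_iff zero_index zero_le_square)
  qed
  obtain a b where X: "X = (a, b)" by (cases X)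
  have "a = 0" "b = 0"
    using Z[of a] Z[of b] T[OF _ X] assms(1) X by (auto simp: sl22_def)
  then show ?thesis using X by (simp add: zero_prod_def)
qed

definition brk :: "mat22 \<Rightarrow> mat22 \<Rightarrow> mat22" where
  "brk X Y = X \<odot> Y - Y \<odot> X"

lemma bounded_bilinear_brk: "bounded_bilinear brk"
  unfolding bilinear_conv_bounded_bilinear[symmetric] bilinear_def
  by (intro conjI allI linearI; simp add: brk_def mmul.add_left mmul.add_right mmul.scaleR_left
      mmul.scaleR_right algebra_simps)

interpretation brk: bounded_bilinear brk
  by (rule bounded_bilinear_brk)

lemma brk_self [simp]: "brk X X = 0" by (simp add: brk_def)

lemma brk_anti: "brk Y X = - brk X Y" by (simp add: brk_def)

lemma brk_sl22: "brk X Y \<in> sl22"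
  by (simp add: brk_def sl22_def mmul_def mat2_simps)

lemma swap_brk: "prod.swap (brk X Y) = brk (prod.swap X) (prod.swap Y)"
  by (simp add: brk_def mmul_def)

lemma tr22_brk: "tr22 (brk X Y) Z = tr22 X (brk Y Z)"
  by (simp add: brk_def tr22_def ip_def mmul_def mat2_simps algebra_simps)

section \<open>The Levi-Civita connection in the left-invariant frame\<close>

text \<open>
  For left-invariant fields \<open>X\<close> and \<open>Y\<close> the Koszul formula reads
  \<open>2 g0 (\<nabla>\<^bsub>X\<^esub> Y) Z = g0 [X, Y] Z - g0 Y [X, Z] - g0 X [Y, Z]\<close>; by invariance of the trace form its
  solution is the following combination of brackets.
\<close>

definition omega :: "mat22 \<Rightarrow> mat22 \<Rightarrow> mat22" where
  "omega X Y = (1/2) *\<^sub>R brk X Y + (1/6) *\<^sub>R (brk (prod.swap X) Y - brk X (prod.swap Y))"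

lemma bounded_bilinear_omega: "bounded_bilinear omega"
  unfolding bilinear_conv_bounded_bilinear[symmetric] bilinear_def
  by (intro conjI allI linearI; simp add: omega_def swap_add swap_scaleR brk.add_left brk.add_right
      brk.scaleR_left brk.scaleR_right algebra_simps)

interpretation omega: bounded_bilinear omega
  by (rule bounded_bilinear_omega)

lemma omega_sl22: "omega X Y \<in> sl22"
  unfolding omega_def using brk_sl22 subspace_sl22
  by (meson subspace_add subspace_diff subspace_scale)

lemma omega_torsion_free: "omega X Y - omega Y X = brk X Y"
proof -
  have "brk Y X = - brk X Y" "brk (prod.swap Y) X = - brk X (prod.swap Y)"
    "brk Y (prod.swap X) = - brk (prod.swap X) Y" by (rule brk_anti)+
  then have "omega X Y - omega Y X = (1/2) *\<^sub>R brk X Y + (1/2) *\<^sub>R brk X Y"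
    by (simp add: omega_def algebra_simps)
  then show ?thesis by (simp flip: scaleR_left.add)
qed

text \<open>
  The map \<open>(X, Y, Z) \<mapsto> tr22 [X, Y] Z\<close> is alternating, and swapping all three arguments leaves it
  unchanged.  Written in terms of it, \<open>g0 (omega X Y) Z\<close> is visibly skew in \<open>Y\<close> and \<open>Z\<close>.
\<close>

lemma omega_metric: "g0 (omega X Y) Z + g0 Y (omega X Z) = 0"
proof -
  have F: "g0 (omega X Y) Z = tr22 (brk X Y) Z / 3 + tr22 (brk (prod.swap X) Y) Z / 6
      - tr22 (brk X (prod.swap Y)) Z / 6 - tr22 (brk X Y) (prod.swap Z) / 6" for Y Z
  proof -
    have s: "tr22 (prod.swap V) W = tr22 V (prod.swap W)" for V W
      by (simp add: tr22_def)
    have a: "tr22 (brk (prod.swap X) Y) (prod.swap Z) = tr22 (brk X (prod.swap Y)) Z"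
      "tr22 (brk X (prod.swap Y)) (prod.swap Z) = tr22 (brk (prod.swap X) Y) Z"
      by (simp_all add: swap_brk flip: s)
    show ?thesis
      unfolding g0_def s
      by (simp add: omega_def tr22.add_left tr22.diff_left tr22.scaleR_left a field_simps)
  qed
  have "tr22 (brk X Z) Y = - tr22 (brk X Y) Z" for X Y Z
    using tr22_brk[of X Z Y] tr22_brk[of X Y Z] brk_anti[of Y Z] tr22_brk[of Y X Z]
    by (metis brk_anti tr22.minus_left tr22_brk tr22_commute)
  note b = this[of X Y Z] this[of "prod.swap X" Y Z] this[of X "prod.swap Y" Z] this[of X Y "prod.swap Z"]
  show ?thesis
    unfolding g0_commute[of Y] F b by simp
qed

text \<open>
  The line \<open>A + t A\<alpha>\<close>, rescaled to determinant one.  For trace-free \<open>\<alpha>\<close> the determinant has no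
  term linear in \<open>t\<close>, so that the rescaling does not change the velocity at \<open>t = 0\<close>.
\<close>

lemma SL2_curve:
  assumes "A \<in> SL2" "trace \<alpha> = 0"
  obtains c where "c 0 = A" "(c has_derivative (\<lambda>t. t *\<^sub>R (A ** \<alpha>))) (at (0::real))"
    "\<forall>\<^sub>F t in at 0. c t \<in> SL2"
proof
  define c where "c t = (1 / sqrt (1 + t\<^sup>2 * det \<alpha>)) *\<^sub>R (A + t *\<^sub>R (A ** \<alpha>))" for t :: real
  show "c 0 = A" by (simp add: c_def)
  show "(c has_derivative (\<lambda>t. t *\<^sub>R (A ** \<alpha>))) (at 0)"
    unfolding c_def by (auto intro!: derivative_eq_intros)
  have "((\<lambda>t::real. 1 + t\<^sup>2 * det \<alpha>) \<longlongrightarrow> 1 + 0\<^sup>2 * det \<alpha>) (at 0)"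
    by (intro tendsto_intros)
  then have ev: "\<forall>\<^sub>F t in at 0. 0 < 1 + t\<^sup>2 * det \<alpha>"
    by (simp add: order_tendsto_iff)
  have "c t \<in> SL2" if "0 < 1 + t\<^sup>2 * det \<alpha>" for t
  proof -
    have "det (A + t *\<^sub>R (A ** \<alpha>)) = det A * (1 + t * trace \<alpha> + t\<^sup>2 * det \<alpha>)"
      by (simp add: mat2_simps power2_eq_square algebra_simps)
    then have 1: "det (A + t *\<^sub>R (A ** \<alpha>)) = 1 + t\<^sup>2 * det \<alpha>"
      using assms by (simp add: SL2_def)
    have "det (s *\<^sub>R B) = s\<^sup>2 * det B" for s and B :: mat2
      by (simp add: mat2_simps power2_eq_square algebra_simps)
    then have "det (c t) = (1 / sqrt (1 + t\<^sup>2 * det \<alpha>))\<^sup>2 * (1 + t\<^sup>2 * det \<alpha>)"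
      unfolding c_def 1[symmetric] .
    also have "(1 / sqrt (1 + t\<^sup>2 * det \<alpha>))\<^sup>2 = 1 / (1 + t\<^sup>2 * det \<alpha>)"
      using that by (simp only: power_divide real_sqrt_pow2 less_imp_le power_one)
    finally have "det (c t) = 1" using that by simp
    then show ?thesis by (simp add: SL2_def)
  qed
  with ev show "\<forall>\<^sub>F t in at 0. c t \<in> SL2" by (rule eventually_mono)
qed

text \<open>
  A relation that holds along \<open>SLSL\<close> may be differentiated in tangential directions, even though
  the derivative is that of a function on the ambient space: the direction is the velocity of a
  curve in \<open>SLSL\<close>.
\<close>

lemma derivative_along_SLSL:
  fixes f :: "mat22 \<Rightarrow> real"
  assumes "p \<in> SLSL" "\<xi> \<in> sl22" "(f has_derivative f') (at p)" "\<And>q. q \<in> SLSL \<Longrightarrow> f q = c"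
  shows "f' (p \<odot> \<xi>) = 0"
proof -
  obtain c1 where c1: "c1 0 = fst p" "(c1 has_derivative (\<lambda>t. t *\<^sub>R (fst p ** fst \<xi>))) (at (0::real))"
    "\<forall>\<^sub>F t in at 0. c1 t \<in> SL2"
    using SL2_curve[of "fst p" "fst \<xi>"] assms(1,2) unfolding sl22_def mem_Times_iff by blast
  obtain c2 where c2: "c2 0 = snd p" "(c2 has_derivative (\<lambda>t. t *\<^sub>R (snd p ** snd \<xi>))) (at (0::real))"
    "\<forall>\<^sub>F t in at 0. c2 t \<in> SL2"
    using SL2_curve[of "snd p" "snd \<xi>"] assms(1,2) unfolding sl22_def mem_Times_iff by blast
  have "((\<lambda>t. (c1 t, c2 t)) has_derivative (\<lambda>t. (t *\<^sub>R (fst p ** fst \<xi>), t *\<^sub>R (snd p ** snd \<xi>)))) (at 0)"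
    by (intro has_derivative_Pair c1 c2)
  moreover have "(f has_derivative f') (at (c1 0, c2 0))" using assms(3) c1 c2 by simp
  ultimately have "((\<lambda>t. f (c1 t, c2 t)) has_derivative
      (\<lambda>t. f' (t *\<^sub>R (fst p ** fst \<xi>), t *\<^sub>R (snd p ** snd \<xi>)))) (at 0)"
    by (rule has_derivative_compose)
  moreover have "((\<lambda>t. f (c1 t, c2 t)) has_derivative (\<lambda>t. 0)) (at 0)"
  proof (rule has_derivative_transform_eventually[where f = "\<lambda>_. c"])
    show "\<forall>\<^sub>F t in at 0. c = f (c1 t, c2 t)"
      using c1(3) c2(3) by eventually_elim (auto simp: assms(4))
    show "c = f (c1 0, c2 0)" using c1 c2 assms by (metis mem_Times_iff prod.collapse)
  qed auto
  ultimately have "(\<lambda>t. f' (t *\<^sub>R (fst p ** fst \<xi>), t *\<^sub>R (snd p ** snd \<xi>))) = (\<lambda>t. 0)"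
    by (rule has_derivative_unique)
  from fun_cong[OF this, of 1] show ?thesis by (simp add: mmul_def)
qed

lemma vector_field_differentiable:
  assumes "vector_field X" "p \<in> SLSL"
  shows "X differentiable (at p)"
  using assms smooth_on_imp_differentiable unfolding vector_field_def by blast

lemma vector_field_left_triv:
  assumes "vector_field Y" "p \<in> SLSL"
  shows "adj22 p \<odot> Y p \<in> sl22"
  using assms tangent_SLSL_iff unfolding vector_field_def by blast

text \<open>
  The derivative of a vector field, seen in the left-invariant frame.  The second summand comes from
  the derivative of the frame.
\<close>

lemma vector_field_derivative:
  assumes Y: "vector_field Y" and p: "p \<in> SLSL" and \<xi>: "\<xi> \<in> sl22"
  defines "y \<equiv> (\<lambda>q. adj22 q \<odot> Y q)"
  shows "y differentiable (at p)"
    and "frechet_derivative y (at p) (p \<odot> \<xi>) \<in> sl22"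
    and "frechet_derivative Y (at p) (p \<odot> \<xi>) = p \<odot> (frechet_derivative y (at p) (p \<odot> \<xi>) + \<xi> \<odot> y p)"
proof -
  have dY: "(Y has_derivative frechet_derivative Y (at p)) (at p)"
    using vector_field_differentiable[OF Y p] by (simp add: frechet_derivative_works)
  have d: "(y has_derivative (\<lambda>v. adj22 p \<odot> frechet_derivative Y (at p) v + adj22 v \<odot> Y p)) (at p)"
    unfolding y_def by (intro bounded_bilinear.FDERIV[OF bounded_bilinear_mmul]
        bounded_linear.has_derivative[OF bounded_linear_adj22] dY has_derivative_ident)
  then show dif: "y differentiable (at p)" by (rule differentiableI)
  have fy: "frechet_derivative y (at p) = (\<lambda>v. adj22 p \<odot> frechet_derivative Y (at p) v + adj22 v \<odot> Y p)"
    using frechet_derivative_at[OF d] by simp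
  have "adj22 (p \<odot> \<xi>) \<odot> Y p = - (\<xi> \<odot> y p)"
    by (simp add: adj22_mmul adj22_sl22[OF \<xi>] y_def mmul.minus_left flip: mmul_assoc)
  then have "adj22 p \<odot> frechet_derivative Y (at p) (p \<odot> \<xi>) = frechet_derivative y (at p) (p \<odot> \<xi>) + \<xi> \<odot> y p"
    by (simp add: fy)
  then show "frechet_derivative Y (at p) (p \<odot> \<xi>) = p \<odot> (frechet_derivative y (at p) (p \<odot> \<xi>) + \<xi> \<odot> y p)"
    by (metis adj22_cancel(2) p)
  have y_sl: "y q \<in> sl22" if "q \<in> SLSL" for q
    unfolding y_def by (rule vector_field_left_triv[OF Y that])
  have tr: "bounded_linear (trace :: mat2 \<Rightarrow> real)"
    unfolding linear_conv_bounded_linear[symmetric]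
    by (auto intro!: linearI simp: trace_2 algebra_simps)
  have d': "(y has_derivative frechet_derivative y (at p)) (at p)"
    using dif by (simp add: frechet_derivative_works)
  have "trace (fst (frechet_derivative y (at p) (p \<odot> \<xi>))) = 0"
    by (rule derivative_along_SLSL[OF p \<xi>, where f = "\<lambda>q. trace (fst (y q))" and c = 0])
      (use y_sl d' in \<open>auto simp: sl22_def intro!: bounded_linear.has_derivative[OF tr] has_derivative_fst\<close>)
  moreover have "trace (snd (frechet_derivative y (at p) (p \<odot> \<xi>))) = 0"
    by (rule derivative_along_SLSL[OF p \<xi>, where f = "\<lambda>q. trace (snd (y q))" and c = 0])
      (use y_sl d' in \<open>auto simp: sl22_def intro!: bounded_linear.has_derivative[OF tr] has_derivative_snd\<close>)
  ultimately show "frechet_derivative y (at p) (p \<odot> \<xi>) \<in> sl22" by (simp add: sl22_def)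
qed

lemma det_has_derivative:
  fixes f :: "'a::real_normed_vector \<Rightarrow> mat2"
  assumes "f differentiable (at x)"
  shows "(\<lambda>x. det (f x)) differentiable (at x)"
proof -
  have "(\<lambda>x. f x $ i $ j) differentiable (at x)" for i j
    by (intro differentiable_linear[OF bounded_linear_vec_nth] assms)
  then show ?thesis unfolding det_2
    by (intro differentiable_diff differentiable_mult)
qed

text \<open>
  \<open>nk_metric\<close> uses the matrix inverse, which is the adjugate divided by the determinant near \<open>SLSL\<close>.
\<close>

lemma nk_metric_differentiable:
  assumes Y: "Y differentiable (at p)" and Z: "Z differentiable (at p)" and p: "p \<in> SLSL"
  shows "(\<lambda>q. nk_metric q (Y q) (Z q)) differentiable (at p)"
proof -
  let ?l = "\<lambda>q V :: mat22. ((1 / det (fst q)) *\<^sub>R (adj2 (fst q) ** fst V),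
    (1 / det (snd q)) *\<^sub>R (adj2 (snd q) ** snd V))"
  have adj2: "bounded_linear adj2"
    unfolding linear_conv_bounded_linear[symmetric]
    by (auto intro!: linearI simp: mat2_simps)
  have fs: "fst differentiable at p" "snd differentiable at p" for p :: mat22
    by (auto intro!: differentiableI bounded_linear_imp_has_derivative bounded_linear_fst bounded_linear_snd)
  have comp: "(\<lambda>q. (1 / det (h q)) *\<^sub>R (adj2 (h q) ** k q)) differentiable (at p)"
    if "h differentiable (at p)" "k differentiable (at p)" "det (h p) = 1" for h k :: "mat22 \<Rightarrow> mat2"
  proof -
    have "(\<lambda>q. adj2 (h q) ** k q) differentiable (at p)"
      using that by (intro differentiable_bilinear[OF matrix_mult_bounded_bilinear] differentiable_linear[OF adj2])
    moreover have "(\<lambda>q. 1 / det (h q)) differentiable (at p)"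
      using that by (intro differentiable_divide det_has_derivative) auto
    ultimately show ?thesis by (rule differentiable_scaleR[rotated])
  qed
  have det1: "det (fst p) = 1" "det (snd p) = 1" using p by (auto simp: SL2_def)
  have l: "(\<lambda>q. ?l q (V q)) differentiable (at p)" if "V differentiable (at p)" for V
  proof -
    have "(\<lambda>q. fst (V q)) differentiable (at p)" "(\<lambda>q. snd (V q)) differentiable (at p)"
      using that by (auto intro: differentiable_linear bounded_linear_fst bounded_linear_snd)
    note comp[OF fs(1) \<open>(\<lambda>q. fst (V q)) differentiable (at p)\<close> det1(1)]
      comp[OF fs(2) \<open>(\<lambda>q. snd (V q)) differentiable (at p)\<close> det1(2)]
    from this[unfolded frechet_derivative_works] show ?thesis
      by (rule differentiableI[OF has_derivative_Pair])
  qed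
  define W :: "mat22 set" where "W = {q. det (fst q) \<noteq> 0 \<and> det (snd q) \<noteq> 0}"
  have "open W"
    unfolding W_def by (intro open_Collect_conj open_Collect_neq)
      (auto simp: det_2 intro!: continuous_intros)
  have "p \<in> W" using det1 by (simp add: W_def)
  moreover have "g0 (?l q (Y q)) (?l q (Z q)) = nk_metric q (Y q) (Z q)" if "q \<in> W" for q
    using that by (simp add: W_def nk_metric_left left_triv_det)
  moreover have "(\<lambda>q. g0 (?l q (Y q)) (?l q (Z q))) differentiable (at p)"
    by (rule differentiable_bilinear[OF bounded_bilinear_g0 l[OF Y] l[OF Z]])
  ultimately show ?thesis by (rule differentiable_cong_open[OF \<open>open W\<close>])
qed

lemma nk_metric_derivative:
  assumes "vector_field Y" "vector_field Z" and p: "p \<in> SLSL" and \<xi>: "\<xi> \<in> sl22"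
  defines "y \<equiv> (\<lambda>q. adj22 q \<odot> Y q)" and "z \<equiv> (\<lambda>q. adj22 q \<odot> Z q)"
  shows "frechet_derivative (\<lambda>q. nk_metric q (Y q) (Z q)) (at p) (p \<odot> \<xi>)
    = g0 (frechet_derivative y (at p) (p \<odot> \<xi>)) (z p) + g0 (y p) (frechet_derivative z (at p) (p \<odot> \<xi>))"
proof -
  have 1: "((\<lambda>q. nk_metric q (Y q) (Z q)) has_derivative
      frechet_derivative (\<lambda>q. nk_metric q (Y q) (Z q)) (at p)) (at p)"
    using nk_metric_differentiable[OF vector_field_differentiable vector_field_differentiable] assms
    by (simp add: frechet_derivative_works)
  have 2: "((\<lambda>q. g0 (y q) (z q)) has_derivative
      (\<lambda>v. g0 (y p) (frechet_derivative z (at p) v) + g0 (frechet_derivative y (at p) v) (z p))) (at p)"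
    using vector_field_derivative(1)[OF _ p \<xi>] assms(1,2) unfolding y_def z_def
    by (intro bounded_bilinear.FDERIV[OF bounded_bilinear_g0]) (simp_all add: frechet_derivative_works)
  \<comment> \<open>The two functions agree on \<open>SLSL\<close>, but not near it, where inverse and adjugate differ.\<close>
  have "frechet_derivative (\<lambda>q. nk_metric q (Y q) (Z q)) (at p) (p \<odot> \<xi>)
      - (g0 (y p) (frechet_derivative z (at p) (p \<odot> \<xi>)) + g0 (frechet_derivative y (at p) (p \<odot> \<xi>)) (z p)) = 0"
    by (rule derivative_along_SLSL[OF p \<xi> has_derivative_diff[OF 1 2], where c = 0])
      (simp add: nk_metric_SLSL y_def z_def)
  then show ?thesis by simp
qed

text \<open>
  The subtracted product cancels the derivative of the left-invariant frame that is part of the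
  ambient derivative of a field, see \<open>covd_nk_connection\<close>.
\<close>

definition nk_connection :: "mat22 \<Rightarrow> mat22 \<Rightarrow> mat22 \<Rightarrow> mat22" where
  "nk_connection p V W =
     p \<odot> (omega (adj22 p \<odot> V) (adj22 p \<odot> W) - (adj22 p \<odot> V) \<odot> (adj22 p \<odot> W))"

lemma covd_nk_connection:
  assumes "vector_field X" "vector_field Y" and p: "p \<in> SLSL"
  shows "covd nk_connection X Y p = p \<odot> (frechet_derivative (\<lambda>q. adj22 q \<odot> Y q) (at p) (X p)
    + omega (adj22 p \<odot> X p) (adj22 p \<odot> Y p))"
proof -
  have x: "X p = p \<odot> (adj22 p \<odot> X p)" using p by simp
  have "frechet_derivative Y (at p) (X p) = p \<odot> (frechet_derivative (\<lambda>q. adj22 q \<odot> Y q) (at p) (X p)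
      + (adj22 p \<odot> X p) \<odot> (adj22 p \<odot> Y p))"
    using vector_field_derivative(3)[OF assms(2) p vector_field_left_triv[OF assms(1) p]]
    unfolding x[symmetric] .
  then show ?thesis
    unfolding covd_def nk_connection_def by (simp flip: mmul.add_right)
qed

lemma is_levi_civita_nk_connection: "is_levi_civita nk_connection"
  unfolding is_levi_civita_def
proof (intro conjI ballI allI impI)
  fix p assume p: "p \<in> SLSL"
  show "bilinear (nk_connection p)"
    unfolding bilinear_def nk_connection_def
    by (intro conjI allI linearI; simp add: mmul.add_left mmul.add_right mmul.scaleR_left mmul.scaleR_right
        omega.add_left omega.add_right omega.scaleR_left omega.scaleR_right algebra_simps mmul.diff_right)
next
  fix X Y p assume X: "vector_field X" and Y: "vector_field Y" and p: "p \<in> SLSL"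
  let ?x = "adj22 p \<odot> X p" and ?y = "adj22 p \<odot> Y p"
  have x: "?x \<in> sl22" "X p = p \<odot> ?x" and y: "?y \<in> sl22" "Y p = p \<odot> ?y"
    using X Y p vector_field_left_triv by auto
  have "frechet_derivative (\<lambda>q. adj22 q \<odot> Y q) (at p) (X p) + omega ?x ?y \<in> sl22"
    using vector_field_derivative(2)[OF Y p x(1)] unfolding x(2)[symmetric]
    by (rule subspace_add[OF subspace_sl22 _ omega_sl22])
  then show "covd nk_connection X Y p \<in> tangent_SLSL p"
    using covd_nk_connection[OF X Y p] p by (simp add: tangent_SLSL_iff)
  have "omega ?x ?y - ?x \<odot> ?y = omega ?y ?x - ?y \<odot> ?x"
    using omega_torsion_free[of ?x ?y] by (simp add: brk_def algebra_simps)
  then show "covd nk_connection X Y p - covd nk_connection Y X p = lie_bracket X Y p"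
    by (simp add: covd_def lie_bracket_def nk_connection_def)
next
  fix X Y Z p assume X: "vector_field X" and Y: "vector_field Y" and Z: "vector_field Z" and p: "p \<in> SLSL"
  let ?x = "adj22 p \<odot> X p"
  have x: "?x \<in> sl22" "X p = p \<odot> ?x" using X p vector_field_left_triv by auto
  show "frechet_derivative (\<lambda>q. nk_metric q (Y q) (Z q)) (at p) (X p) =
      nk_metric p (covd nk_connection X Y p) (Z p) + nk_metric p (Y p) (covd nk_connection X Z p)"
    using nk_metric_derivative[OF Y Z p x(1)] x(2)
      omega_metric[of ?x "adj22 p \<odot> Y p" "adj22 p \<odot> Z p"] p
    by (simp add: covd_nk_connection[OF X Y p] covd_nk_connection[OF X Z p] nk_metric_SLSL
        g0.add_left g0.add_right)
qed

lemma vector_field_left_invariant: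
  assumes "\<xi> \<in> sl22"
  shows "vector_field (\<lambda>q. q \<odot> \<xi>)"
proof -
  have "smooth_on UNIV (\<lambda>q. q \<odot> \<xi>)"
    using times_differentiable_on_linear[OF mmul.bounded_linear_left open_UNIV times_differentiable_on_ident]
    unfolding smooth_on_def by blast
  then show ?thesis using assms unfolding vector_field_def tangent_SLSL_eq by blast
qed

text \<open>
  The difference of two Levi-Civita connections is a symmetric tensor that is skew in its last two
  arguments with respect to the metric, and such a tensor vanishes.
\<close>

lemma is_levi_civita_unique:
  assumes \<Gamma>: "is_levi_civita \<Gamma>" and \<Delta>: "is_levi_civita \<Delta>" and p: "p \<in> SLSL"
    and "\<xi> \<in> sl22" "\<eta> \<in> sl22"
  shows "\<Gamma> p (p \<odot> \<xi>) (p \<odot> \<eta>) = \<Delta> p (p \<odot> \<xi>) (p \<odot> \<eta>)"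
proof -
  define F where "F \<xi> = (\<lambda>q. q \<odot> \<xi>)" for \<xi>
  define E where "E \<xi> \<eta> = adj22 p \<odot> (\<Gamma> p (p \<odot> \<xi>) (p \<odot> \<eta>) - \<Delta> p (p \<odot> \<xi>) (p \<odot> \<eta>))" for \<xi> \<eta>
  have F: "vector_field (F \<xi>)" if "\<xi> \<in> sl22" for \<xi>
    using vector_field_left_invariant[OF that] by (simp add: F_def)
  have E_covd: "E \<xi> \<eta> = adj22 p \<odot> covd \<Gamma> (F \<xi>) (F \<eta>) p - adj22 p \<odot> covd \<Delta> (F \<xi>) (F \<eta>) p" for \<xi> \<eta>
    by (simp add: E_def covd_def F_def mmul.diff_right mmul.add_right)
  have tan: "adj22 p \<odot> covd \<Gamma> (F \<xi>) (F \<eta>) p \<in> sl22" "covd \<Gamma> (F \<xi>) (F \<eta>) p - covd \<Gamma> (F \<eta>) (F \<xi>) p = lie_bracket (F \<xi>) (F \<eta>) p"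
    if "is_levi_civita \<Gamma>" "\<xi> \<in> sl22" "\<eta> \<in> sl22" for \<Gamma> \<xi> \<eta>
    using that(1) F[OF that(2)] F[OF that(3)] p
    unfolding is_levi_civita_def tangent_SLSL_iff[OF p, symmetric] by blast+
  have E_sl: "E \<xi> \<eta> \<in> sl22" if "\<xi> \<in> sl22" "\<eta> \<in> sl22" for \<xi> \<eta>
    unfolding E_covd using tan[OF \<Gamma> that] tan[OF \<Delta> that] subspace_sl22 by (metis subspace_diff)
  have E_sym: "E \<xi> \<eta> = E \<eta> \<xi>" if "\<xi> \<in> sl22" "\<eta> \<in> sl22" for \<xi> \<eta>
    using tan(2)[OF \<Gamma> that] tan(2)[OF \<Delta> that]
    unfolding E_covd mmul.diff_right[symmetric] by (simp add: algebra_simps)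
  have met: "frechet_derivative (\<lambda>q. nk_metric q (F \<eta> q) (F \<zeta> q)) (at p) (F \<xi> p) =
      g0 (adj22 p \<odot> covd \<Gamma> (F \<xi>) (F \<eta>) p) \<zeta> + g0 \<eta> (adj22 p \<odot> covd \<Gamma> (F \<xi>) (F \<zeta>) p)"
    if "is_levi_civita \<Gamma>" "\<xi> \<in> sl22" "\<eta> \<in> sl22" "\<zeta> \<in> sl22" for \<Gamma> \<xi> \<eta> \<zeta>
  proof -
    have "adj22 p \<odot> F v p = v" for v using p by (simp add: F_def)
    moreover have "frechet_derivative (\<lambda>q. nk_metric q (F \<eta> q) (F \<zeta> q)) (at p) (F \<xi> p) =
      nk_metric p (covd \<Gamma> (F \<xi>) (F \<eta>) p) (F \<zeta> p) + nk_metric p (F \<eta> p) (covd \<Gamma> (F \<xi>) (F \<zeta>) p)"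
      using that F p unfolding is_levi_civita_def by blast
    ultimately show ?thesis using p by (simp add: nk_metric_SLSL)
  qed
  have E_skew: "g0 (E \<xi> \<eta>) \<zeta> = - g0 (E \<xi> \<zeta>) \<eta>" if "\<xi> \<in> sl22" "\<eta> \<in> sl22" "\<zeta> \<in> sl22" for \<xi> \<eta> \<zeta>
    using met[OF \<Gamma> that] met[OF \<Delta> that]
    unfolding E_covd g0_commute[of \<eta>] by (simp add: g0.diff_left)
  have "g0 (E \<xi> \<eta>) \<zeta> = 0" if "\<zeta> \<in> sl22" for \<zeta>
  proof -
    have "g0 (E \<xi> \<eta>) \<zeta> = - g0 (E \<zeta> \<xi>) \<eta>"
      using E_skew[of \<xi> \<eta> \<zeta>] E_sym[of \<xi> \<zeta>] assms that by simp
    also have "\<dots> = g0 (E \<eta> \<zeta>) \<xi>"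
      using E_skew[of \<zeta> \<xi> \<eta>] E_sym[of \<zeta> \<eta>] assms that by simp
    also have "\<dots> = - g0 (E \<xi> \<eta>) \<zeta>"
      using E_skew[of \<eta> \<zeta> \<xi>] E_sym[of \<eta> \<xi>] assms that by simp
    finally show ?thesis by simp
  qed
  then have "E \<xi> \<eta> = 0" using sl22_nondegenerate E_sl assms by blast
  then show ?thesis unfolding E_def by (metis adj22_cancel(2) eq_iff_diff_eq_0 mmul.zero_right p)
qed

lemma levi_civita_SLSL:
  assumes "p \<in> SLSL" "\<xi> \<in> sl22" "\<eta> \<in> sl22"
  shows "levi_civita p (p \<odot> \<xi>) (p \<odot> \<eta>) = p \<odot> (omega \<xi> \<eta> - \<xi> \<odot> \<eta>)"
proof -
  have "is_levi_civita levi_civita"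
    unfolding levi_civita_def by (rule someI[where P = is_levi_civita, OF is_levi_civita_nk_connection])
  then have "levi_civita p (p \<odot> \<xi>) (p \<odot> \<eta>) = nk_connection p (p \<odot> \<xi>) (p \<odot> \<eta>)"
    using is_levi_civita_unique is_levi_civita_nk_connection assms by blast
  then show ?thesis using assms(1) by (simp add: nk_connection_def)
qed

section \<open>Curvature of J-invariant planes\<close>

text \<open>
  The curvature tensor \<open>R(X, Y)Z\<close> of the connection \<open>omega\<close> for left-invariant fields.
\<close>

definition Omega :: "mat22 \<Rightarrow> mat22 \<Rightarrow> mat22 \<Rightarrow> mat22" where
  "Omega X Y Z = omega X (omega Y Z) - omega Y (omega X Z) - omega (brk X Y) Z"

lemma Omega_skew: "g0 (Omega X Y Z) W = - g0 (Omega X Y W) Z"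
proof -
  have s: "g0 (omega A B) C = - g0 (omega A C) B" for A B C
    using omega_metric[of A B C] by (simp add: g0_commute)
  have "g0 (omega X (omega Y Z)) W = g0 (omega Y (omega X W)) Z" for X Y
    using s[of X "omega Y Z" W] s[of Y "omega X W" Z] by (simp add: g0_commute)
  from this[of X Y] this[of Y X] s[of "brk X Y" Z W] show ?thesis
    unfolding Omega_def by (simp add: g0.diff_left)
qed

lemma Omega_linear:
  "Omega X (a *\<^sub>R Y + b *\<^sub>R Y') Z = a *\<^sub>R Omega X Y Z + b *\<^sub>R Omega X Y' Z"
  by (simp add: Omega_def omega.add_left omega.add_right omega.scaleR_left omega.scaleR_right
      brk.add_right brk.scaleR_right algebra_simps)

lemma Omega_self: "Omega X X Z = 0"
  by (simp add: Omega_def omega.zero_left)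

text \<open>
  The left-trivialization of \<open>sqrt 3 J\<close>; leaving out the factor keeps all coefficients rational.
\<close>

definition rotJ :: "mat22 \<Rightarrow> mat22" where
  "rotJ X = (fst X - 2 *\<^sub>R snd X, 2 *\<^sub>R fst X - snd X)"

lemma rotJ_rotJ: "rotJ (rotJ X) = - 3 *\<^sub>R X"
  by (simp add: rotJ_def prod_eq_iff vec_eq_iff)

lemma rotJ_scaleR: "rotJ (c *\<^sub>R X) = c *\<^sub>R rotJ X"
  by (simp add: rotJ_def algebra_simps)

lemma g0_rotJ: "g0 X (rotJ X) = 0" "g0 (rotJ X) (rotJ X) = 3 * g0 X X"
  by (simp_all add: g0_def tr22_def rotJ_def ip.diff_left ip.diff_right ip.scaleR_left ip.scaleR_right
      ip_commute[of "snd X" "fst X"] field_simps)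

lemma left_triv_mmul:
  assumes "p \<in> SLSL"
  shows "left_triv p (p \<odot> X) = X"
  using assms by (simp add: left_triv_SLSL)

lemma J_map_eq:
  assumes "p \<in> SLSL"
  shows "J_map p (p \<odot> X) = p \<odot> ((1 / sqrt 3) *\<^sub>R rotJ X)"
  unfolding J_map_def left_triv_mmul[OF assms]
  by (simp add: case_prod_beta mmul_def rotJ_def matrix_mult.scaleR_right)

lemma P_map_eq:
  assumes "p \<in> SLSL"
  shows "P_map p (p \<odot> X) = p \<odot> prod.swap X"
  unfolding P_map_def left_triv_mmul[OF assms] by (simp add: case_prod_beta mmul_def)

definition com :: "mat2 \<Rightarrow> mat2 \<Rightarrow> mat2" where
  "com a b = a ** b - b ** a"

lemma bounded_bilinear_com: "bounded_bilinear com"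
  unfolding bilinear_conv_bounded_bilinear[symmetric] bilinear_def
  by (intro conjI allI linearI; simp add: com_def matrix_mult.add_left matrix_mult.add_right
      matrix_mult.scaleR_left matrix_mult.scaleR_right algebra_simps)

interpretation com: bounded_bilinear com
  by (rule bounded_bilinear_com)

lemma com_self [simp]: "com a a = 0" by (simp add: com_def)

lemma com_anti: "com b a = - com a b" by (simp add: com_def)

lemma brk_Pair: "brk (a, b) (c, d) = (com a c, com b d)"
  by (simp add: brk_def mmul_def com_def)

lemma omega_Pair: "omega (a, b) (c, d) =
   ((1/2) *\<^sub>R com a c + (1/6) *\<^sub>R (com b c - com a d), (1/2) *\<^sub>R com b d + (1/6) *\<^sub>R (com a d - com b c))"
  by (simp add: omega_def brk_Pair)

text \<open>
  All brackets among the components of \<open>(a, b)\<close> and \<open>rotJ (a, b)\<close> are multiples of \<open>[a, b]\<close>, so that the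
  inner \<open>omega\<close> of each term is a pair of multiples of it.
\<close>

lemma Omega_rotJ:
  fixes a b :: mat2
  defines "w \<equiv> com a b"
  shows "Omega (a, b) (rotJ (a, b)) (a, b) = - (2/3) *\<^sub>R (com a w, com b w)"
proof -
  note bil = com.add_left com.add_right com.diff_left com.diff_right com.scaleR_left com.scaleR_right
    com.minus_left com.minus_right
  have ba: "com b a = - w" using com_anti[of b a] by (simp add: w_def)
  have wa: "com w a = - com a w" "com w b = - com b w" by (rule com_anti)+
  have 1: "omega (rotJ (a, b)) (a, b) = (w, w)"
    by (simp add: rotJ_def omega_Pair bil ba w_def[symmetric] flip: scaleR_left.add)
  have 2: "omega (a, b) (a, b) = (- (1/3) *\<^sub>R w, (1/3) *\<^sub>R w)"
    by (simp add: omega_Pair ba w_def[symmetric] flip: scaleR_left.add scaleR_minus_right)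
      (simp add: vec_eq_iff)
  have 3: "brk (a, b) (rotJ (a, b)) = (- 2 *\<^sub>R w, - 2 *\<^sub>R w)"
    by (simp add: rotJ_def brk_Pair bil ba w_def[symmetric])
  show ?thesis
    unfolding Omega_def 1 2 3
    by (simp add: rotJ_def omega_Pair bil wa) (simp add: vec_eq_iff field_simps)
qed

text \<open>
  Up to scaling, the commutator on trace-free matrices is a cross product of \<open>\<real>\<^sup>3\<close> with the indefinite
  inner product \<open>ip\<close>; these are its expansions of double products.
\<close>

lemma com_com:
  assumes "trace a = 0" "trace b = 0"
  shows "com a (com a b) = 4 *\<^sub>R (ip a a *\<^sub>R b - ip a b *\<^sub>R a)"
    and "com b (com a b) = 4 *\<^sub>R (ip a b *\<^sub>R b - ip b b *\<^sub>R a)"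
proof -
  have "a$2$2 = - a$1$1" "b$2$2 = - b$1$1" using assms by (simp_all add: trace_2)
  then show "com a (com a b) = 4 *\<^sub>R (ip a a *\<^sub>R b - ip a b *\<^sub>R a)"
    and "com b (com a b) = 4 *\<^sub>R (ip a b *\<^sub>R b - ip b b *\<^sub>R a)"
    by (simp_all add: com_def ip_def mat2_simps field_simps)
qed

text \<open>
  The Codazzi equation at a point.  If \<open>a\<close> and \<open>b\<close> do not commute, then they are linearly independent,
  and comparing coefficients in both components leaves only the stated relations.
\<close>

lemma curvature_dichotomy:
  assumes "trace a = 0" "trace b = 0"
    and eq: "Omega (a, b) (rotJ (a, b)) (a, b) = p *\<^sub>R (a, b) + q *\<^sub>R rotJ (a, b)"
  shows "com a b = 0 \<or> ip a a = 2 * ip a b \<and> ip b b = 2 * ip a b"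
proof (cases "com a b = 0")
  case False
  have indep: "s = 0 \<and> t = 0" if "s *\<^sub>R a + t *\<^sub>R b = 0" for s t
  proof -
    have "com (s *\<^sub>R a + t *\<^sub>R b) b = 0" "com a (s *\<^sub>R a + t *\<^sub>R b) = 0"
      unfolding that by (simp_all add: com.zero_left com.zero_right)
    then show ?thesis using False
      by (simp add: com.add_left com.add_right com.scaleR_left com.scaleR_right)
  qed
  have "- (8/3) *\<^sub>R (ip a a *\<^sub>R b - ip a b *\<^sub>R a) = p *\<^sub>R a + q *\<^sub>R (a - 2 *\<^sub>R b)"
    "- (8/3) *\<^sub>R (ip a b *\<^sub>R b - ip b b *\<^sub>R a) = p *\<^sub>R b + q *\<^sub>R (2 *\<^sub>R a - b)"
    using eq unfolding Omega_rotJ com_com[OF assms(1,2)] by (simp_all add: rotJ_def)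
  then have "(8/3 * ip a b - p - q) *\<^sub>R a + (- (8/3) * ip a a + 2 * q) *\<^sub>R b = 0"
    "(8/3 * ip b b - 2 * q) *\<^sub>R a + (- (8/3) * ip a b - p + q) *\<^sub>R b = 0"
    by (simp_all add: algebra_simps)
  from this[THEN indep] show ?thesis by simp
qed simp

lemma com_eq_0_collinear:
  assumes "trace a = 0" "trace b = 0" "com a b = 0"
  obtains n s t where "a = s *\<^sub>R n" "b = t *\<^sub>R n" "s \<noteq> 0 \<or> t \<noteq> 0"
proof (cases "a = 0")
  case True
  then show ?thesis using that[of 0 b 1] by simp
next
  case False
  have tr: "a$2$2 = - a$1$1" "b$2$2 = - b$1$1" using assms by (simp_all add: trace_2)
  have m: "a$1$2 * b$2$1 = a$2$1 * b$1$2" "a$1$1 * b$1$2 = a$1$2 * b$1$1" "a$1$1 * b$2$1 = a$2$1 * b$1$1"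
  proof -
    have "com a b $ 1 $ 1 = a$1$2 * b$2$1 - a$2$1 * b$1$2"
      "com a b $ 1 $ 2 = 2 * (a$1$1 * b$1$2 - a$1$2 * b$1$1)"
      "com a b $ 2 $ 1 = 2 * (a$2$1 * b$1$1 - a$1$1 * b$2$1)"
      by (simp_all add: com_def matrix_mult_2_nth tr algebra_simps)
    then show "a$1$2 * b$2$1 = a$2$1 * b$1$2" "a$1$1 * b$1$2 = a$1$2 * b$1$1" "a$1$1 * b$2$1 = a$2$1 * b$1$1"
      using assms(3) by simp_all
  qed
  have "\<exists>t. b = t *\<^sub>R a"
  proof -
    consider "a$1$1 \<noteq> 0" | "a$1$2 \<noteq> 0" | "a$2$1 \<noteq> 0" using False tr by (auto simp: mat2_eq_iff)
    then show ?thesis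
    proof cases
      case 1
      then show ?thesis using m tr
        by (intro exI[of _ "b$1$1 / a$1$1"]) (simp add: mat2_eq_iff field_simps)
    next
      case 2
      then show ?thesis using m tr by (intro exI[of _ "b$1$2 / a$1$2"]) (simp add: mat2_eq_iff field_simps)
    next
      case 3
      then show ?thesis using m tr by (intro exI[of _ "b$2$1 / a$2$1"]) (simp add: mat2_eq_iff field_simps)
    qed
  qed
  then show ?thesis using that[of 1 a] by auto
qed

text \<open>
  Both \<open>a\<close> and \<open>b\<close> are multiples of one matrix \<open>n\<close>, and the plane consists of all pairs of multiples
  of \<open>n\<close>.
\<close>

lemma swap_in_plane:
  assumes "trace a = 0" "trace b = 0" "com a b = 0"
  shows "\<exists>p q. prod.swap (a, b) = p *\<^sub>R (a, b) + q *\<^sub>R rotJ (a, b)"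
    "\<exists>p q. prod.swap (rotJ (a, b)) = p *\<^sub>R (a, b) + q *\<^sub>R rotJ (a, b)"
proof -
  obtain n s t where n: "a = s *\<^sub>R n" "b = t *\<^sub>R n" "s \<noteq> 0 \<or> t \<noteq> 0" using com_eq_0_collinear[OF assms] .
  define d where "d = 2 * (s\<^sup>2 - s * t + t\<^sup>2)"
  have all: "\<exists>p q. (x *\<^sub>R n, y *\<^sub>R n) = p *\<^sub>R (a, b) + q *\<^sub>R rotJ (a, b)" for x y
  proof -
    have "d = s\<^sup>2 + t\<^sup>2 + (s - t)\<^sup>2" unfolding d_def by (simp add: power2_eq_square algebra_simps)
    then have d: "d \<noteq> 0" using n(3) by (smt (verit) zero_le_power2 zero_eq_power2)
    \<comment> \<open>\<open>d\<close> is the determinant in Cramer's rule for \<open>p s + q (s - 2 t) = x\<close>, \<open>p t + q (2 s - t) = y\<close>.\<close>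
    define p where "p = (x * (2 * s - t) - y * (s - 2 * t)) / d"
    define q where "q = (s * y - t * x) / d"
    have "p * s + q * (s - 2 * t) = x" "p * t + q * (2 * s - t) = y"
      using d unfolding p_def q_def by (simp_all add: field_simps) (simp_all add: d_def power2_eq_square algebra_simps)
    note pq = this
    have "(x *\<^sub>R n, y *\<^sub>R n) = p *\<^sub>R (a, b) + q *\<^sub>R rotJ (a, b)"
      by (simp add: n rotJ_def flip: pq) (simp add: algebra_simps)
    then show ?thesis by blast
  qed
  show "\<exists>p q. prod.swap (a, b) = p *\<^sub>R (a, b) + q *\<^sub>R rotJ (a, b)"
    using all[of t s] by (simp add: n)
  show "\<exists>p q. prod.swap (rotJ (a, b)) = p *\<^sub>R (a, b) + q *\<^sub>R rotJ (a, b)"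
    using all[of "2 * s - t" "s - 2 * t"] by (simp add: n rotJ_def algebra_simps)
qed

text \<open>
  The two relations are equivalent to \<open>P X\<close> being orthogonal to \<open>X\<close> and to \<open>J X\<close> for \<open>X = (a, b)\<close>.
\<close>

lemma swap_normal_to_plane:
  assumes "ip a a = 2 * ip a b" "ip b b = 2 * ip a b"
  shows "g0 (prod.swap (p *\<^sub>R (a, b) + q *\<^sub>R rotJ (a, b))) (r *\<^sub>R (a, b) + s *\<^sub>R rotJ (a, b)) = 0"
  using assms
  by (simp add: g0_def tr22_def rotJ_def ip.add_left ip.add_right ip.diff_left ip.diff_right
      ip.scaleR_left ip.scaleR_right ip_commute[of b a] algebra_simps)

text \<open>For \<open>X = (a, b)\<close> the left-hand side is \<open>- 3 g0 X X\<^sup>2\<close> times the sectional curvature of the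
  plane spanned by \<open>X\<close> and \<open>rotJ X\<close>.\<close>

lemma plane_curvature:
  assumes "trace a = 0" "trace b = 0" "ip a a = 2 * ip a b" "ip b b = 2 * ip a b"
  shows "g0 (Omega (a, b) (rotJ (a, b)) (a, b)) (rotJ (a, b)) = 4 * (g0 (a, b) (a, b))\<^sup>2"
proof -
  have "Omega (a, b) (rotJ (a, b)) (a, b) = (8/3 * ip a b) *\<^sub>R rotJ (a, b)"
    unfolding Omega_rotJ com_com[OF assms(1,2)] assms(3,4)
    by (simp add: rotJ_def algebra_simps)
  then have "g0 (Omega (a, b) (rotJ (a, b)) (a, b)) (rotJ (a, b)) = 8 * ip a b * g0 (a, b) (a, b)"
    by (simp add: g0.scaleR_left g0_rotJ)
  moreover have "g0 (a, b) (a, b) = 2 * ip a b"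
    by (simp add: g0_def tr22_def assms ip_commute[of b a])
  ultimately show ?thesis by (simp add: power2_eq_square)
qed

section \<open>The moving frame of a totally geodesic almost complex surface\<close>

lemma sl22_iff_adj22: "X \<in> sl22 \<longleftrightarrow> adj22 X + X = 0"
  by (auto simp: sl22_def adj22_def prod_eq_iff mat2_simps)

text \<open>
  One chart of a totally geodesic almost complex surface, with the hypotheses that are local in
  nature.
\<close>

locale totally_geodesic_patch =
  fixes U :: "(real^2) set" and \<phi> :: "real^2 \<Rightarrow> mat22"
  assumes open_U: "open U"
    and smooth: "smooth_on U \<phi>"
    and in_SLSL: "u \<in> U \<Longrightarrow> \<phi> u \<in> SLSL"
    and immersion: "u \<in> U \<Longrightarrow> inj (frechet_derivative \<phi> (at u))"
    and J_invariant: "u \<in> U \<Longrightarrow> J_map (\<phi> u) ` tangent_plane \<phi> u \<subseteq> tangent_plane \<phi> u"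
    and nondegenerate: "u \<in> U \<Longrightarrow> V \<in> tangent_plane \<phi> u \<Longrightarrow>
      (\<forall>W\<in>tangent_plane \<phi> u. nk_metric (\<phi> u) V W = 0) \<Longrightarrow> V = 0"
    and geodesic: "u \<in> U \<Longrightarrow> second_fundamental_form \<phi> u a b = 0"
begin

text \<open>
  The Maurer-Cartan form of \<open>\<phi>\<close>, evaluated on the coordinate fields.
\<close>

definition e :: "2 \<Rightarrow> real^2 \<Rightarrow> mat22" where
  "e i u = adj22 (\<phi> u) \<odot> partial_deriv i \<phi> u"

definition frame :: "real^2 \<Rightarrow> real^2 \<Rightarrow> mat22" where
  "frame u v = v$1 *\<^sub>R e 1 u + v$2 *\<^sub>R e 2 u"

text \<open>
  The left-trivialization of \<open>\<nabla>\<^bsub>\<partial>i\<^esub> d\<phi>(\<partial>j)\<close>, see \<open>covd_along_phi\<close>.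
\<close>

definition D :: "2 \<Rightarrow> 2 \<Rightarrow> real^2 \<Rightarrow> mat22" where
  "D i j u = partial_deriv i (e j) u + omega (e i u) (e j u)"

abbreviation G :: "real^2 \<Rightarrow> real^2^2" where
  "G \<equiv> induced_metric \<phi>"

lemma smooth_e: "smooth_on U (e i)"
  unfolding e_def[abs_def]
  by (intro smooth_on_bilinear[OF bounded_bilinear_mmul] smooth_on_linear[OF bounded_linear_adj22]
      smooth_on_partial_deriv smooth open_U)

lemma differentiable_e:
  assumes "u \<in> U"
  shows "e i differentiable (at u)" "partial_deriv j (e i) differentiable (at u)"
  using smooth_on_imp_differentiable[OF _ assms] smooth_e smooth_on_partial_deriv by blast+

lemma differentiable_phi:
  assumes "u \<in> U"
  shows "\<phi> differentiable (at u)" "partial_deriv i \<phi> differentiable (at u)"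
  using smooth_on_imp_differentiable[OF _ assms] smooth smooth_on_partial_deriv by blast+

lemma partial_deriv_phi:
  assumes "u \<in> U"
  shows "partial_deriv i \<phi> u = \<phi> u \<odot> e i u"
  using in_SLSL[OF assms] by (simp add: e_def)

lemma frechet_derivative_phi:
  assumes "u \<in> U"
  shows "frechet_derivative \<phi> (at u) v = \<phi> u \<odot> frame u v"
proof -
  have lin: "linear (frechet_derivative \<phi> (at u))"
    by (rule linear_frechet_derivative[OF differentiable_phi(1)[OF assms]])
  have "v = v$1 *\<^sub>R axis 1 1 + v$2 *\<^sub>R axis 2 1"
    by (simp add: vec_eq_iff forall_2 axis_def)
  then have "frechet_derivative \<phi> (at u) v = frechet_derivative \<phi> (at u) (v$1 *\<^sub>R axis 1 1 + v$2 *\<^sub>R axis 2 1)"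
    by simp
  also have "\<dots> = v$1 *\<^sub>R partial_deriv 1 \<phi> u + v$2 *\<^sub>R partial_deriv 2 \<phi> u"
    by (simp add: linear_add[OF lin] linear_scale[OF lin] partial_deriv_def)
  finally show ?thesis
    by (simp add: partial_deriv_phi[OF assms] frame_def mmul.add_right mmul.scaleR_right)
qed

lemma tangent_plane_eq:
  assumes "u \<in> U"
  shows "tangent_plane \<phi> u = (\<odot>) (\<phi> u) ` range (frame u)"
  unfolding tangent_plane_def using frechet_derivative_phi[OF assms] by (auto simp: image_iff)

lemma frame_vector: "frame u (vector [a, b]) = a *\<^sub>R e 1 u + b *\<^sub>R e 2 u"
  by (simp add: frame_def)

lemma e1_tangent:
  assumes u: "u \<in> U"
  shows "\<phi> u \<odot> e 1 u \<in> tangent_plane \<phi> u"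
proof -
  have "e 1 u = frame u (vector [1, 0])" by (simp add: frame_vector)
  then show ?thesis unfolding tangent_plane_eq[OF u] by blast
qed

lemma frame_injective:
  assumes "u \<in> U" "frame u v = 0"
  shows "v = 0"
proof -
  have "frechet_derivative \<phi> (at u) v = frechet_derivative \<phi> (at u) 0"
    using assms by (simp add: frechet_derivative_phi) (simp add: frame_def)
  then show ?thesis using immersion[OF assms(1)] by (meson injD)
qed

lemma e_independent:
  assumes "u \<in> U" "a *\<^sub>R e 1 u + b *\<^sub>R e 2 u = 0"
  shows "a = 0" "b = 0"
proof -
  have "vector [a, b] = (0 :: real^2)"
    using frame_injective[OF assms(1), of "vector [a, b]"] assms(2) by (simp add: frame_vector)
  then show "a = 0" "b = 0" by (metis vector_2 zero_index)+
qed

text \<open>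
  The condition on \<open>e i u\<close> is the derivative of the relation \<open>adj22 \<phi> \<odot> \<phi> = unit22\<close>.
\<close>

lemma e_sl22:
  assumes u: "u \<in> U"
  shows "e i u \<in> sl22"
proof -
  have "partial_deriv i (\<lambda>u. unit22) u = partial_deriv i (\<lambda>u. adj22 (\<phi> u) \<odot> \<phi> u) u"
    using in_SLSL adj22_mmul_SLSL by (intro partial_deriv_cong_open[OF open_U u]) auto
  also have "\<dots> = adj22 (\<phi> u) \<odot> partial_deriv i \<phi> u + adj22 (partial_deriv i \<phi> u) \<odot> \<phi> u"
    using differentiable_phi[OF u]
    by (simp add: partial_deriv_bilinear[OF bounded_bilinear_mmul]
        differentiable_linear[OF bounded_linear_adj22] partial_deriv_linear[OF bounded_linear_adj22])
  also have "\<dots> = e i u + adj22 (e i u)"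
    using in_SLSL[OF u] adj22_mmul_SLSL(1)[OF in_SLSL[OF u]]
    by (simp add: partial_deriv_phi[OF u] adj22_mmul flip: mmul_assoc)
  finally show ?thesis by (simp add: sl22_iff_adj22 partial_deriv_const add.commute)
qed

lemma frame_sl22: "u \<in> U \<Longrightarrow> frame u v \<in> sl22"
  unfolding frame_def using e_sl22 subspace_sl22 by (simp add: subspace_add subspace_scale)

lemma partial_deriv_e_sl22:
  assumes u: "u \<in> U"
  shows "partial_deriv i (e j) u \<in> sl22"
proof -
  have "partial_deriv i (\<lambda>u. 0) u = partial_deriv i (\<lambda>u. adj22 (e j u) + e j u) u"
    using e_sl22 by (intro partial_deriv_cong_open[OF open_U u]) (auto simp: sl22_iff_adj22)
  then show ?thesis
    using differentiable_e[OF u]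
    by (simp add: sl22_iff_adj22 partial_deriv_const partial_deriv_add
        differentiable_linear[OF bounded_linear_adj22] partial_deriv_linear[OF bounded_linear_adj22])
qed

lemma D_sl22: "u \<in> U \<Longrightarrow> D i j u \<in> sl22"
  unfolding D_def using partial_deriv_e_sl22 omega_sl22 subspace_sl22 by (simp add: subspace_add)

lemma second_derivative_phi:
  assumes u: "u \<in> U"
  shows "partial_deriv i (partial_deriv j \<phi>) u = \<phi> u \<odot> (partial_deriv i (e j) u + e i u \<odot> e j u)"
proof -
  have "partial_deriv i (partial_deriv j \<phi>) u = partial_deriv i (\<lambda>u. \<phi> u \<odot> e j u) u"
    using partial_deriv_phi differentiable_phi(2)[OF u] by (intro partial_deriv_cong_open[OF open_U u])
  also have "\<dots> = \<phi> u \<odot> partial_deriv i (e j) u + (\<phi> u \<odot> e i u) \<odot> e j u"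
    using differentiable_phi(1)[OF u] differentiable_e(1)[OF u]
    by (simp add: partial_deriv_bilinear[OF bounded_bilinear_mmul] partial_deriv_phi[OF u])
  finally show ?thesis by (simp add: mmul.add_right mmul_assoc)
qed

text \<open>
  This is the symmetry of the second derivatives of \<open>\<phi>\<close>.
\<close>

lemma Maurer_Cartan:
  assumes u: "u \<in> U"
  shows "partial_deriv i (e j) u - partial_deriv j (e i) u = - brk (e i u) (e j u)"
proof -
  have "partial_deriv i (e j) u + e i u \<odot> e j u = partial_deriv j (e i) u + e j u \<odot> e i u"
    using partial_deriv_commute[OF open_U u smooth, of i j] second_derivative_phi[OF u]
    by (simp add: mmul_cancel[OF in_SLSL[OF u]])
  then show ?thesis by (simp add: brk_def algebra_simps)
qed

lemma D_symmetric:
  assumes u: "u \<in> U"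
  shows "D i j u = D j i u"
  using Maurer_Cartan[OF u, of i j] omega_torsion_free[of "e i u" "e j u"]
  by (simp add: D_def algebra_simps)

lemma covd_along_phi:
  assumes u: "u \<in> U"
  shows "covd_along \<phi> (axis i 1) (\<lambda>u'. frechet_derivative \<phi> (at u') (axis j 1)) u = \<phi> u \<odot> D i j u"
proof -
  have "covd_along \<phi> (axis i 1) (\<lambda>u'. frechet_derivative \<phi> (at u') (axis j 1)) u
      = partial_deriv i (partial_deriv j \<phi>) u + levi_civita (\<phi> u) (partial_deriv i \<phi> u) (partial_deriv j \<phi> u)"
    by (simp add: covd_along_def partial_deriv_def[abs_def])
  also have "\<dots> = \<phi> u \<odot> D i j u"
    using in_SLSL[OF u] e_sl22[OF u]
    by (simp add: second_derivative_phi[OF u] partial_deriv_phi[OF u] levi_civita_SLSL D_def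
        flip: mmul.add_right)
  finally show ?thesis .
qed

lemma e1_nonzero: "u \<in> U \<Longrightarrow> e 1 u \<noteq> 0"
  using e_independent[of u 1 0] by auto

text \<open>Since \<open>J\<close> has no real eigenvalue, \<open>e 1 u\<close> and \<open>rotJ (e 1 u)\<close> span the tangent plane.\<close>

lemma rotJ_e1:
  assumes u: "u \<in> U"
  obtains x y where "rotJ (e 1 u) = x *\<^sub>R e 1 u + y *\<^sub>R e 2 u" "y \<noteq> 0"
proof -
  have "\<phi> u \<odot> e 1 u \<in> tangent_plane \<phi> u" by (rule e1_tangent[OF u])
  then have "\<phi> u \<odot> ((1 / sqrt 3) *\<^sub>R rotJ (e 1 u)) \<in> tangent_plane \<phi> u"
    using J_invariant[OF u] J_map_eq[OF in_SLSL[OF u]] by (metis image_subset_iff)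
  then obtain v where "(1 / sqrt 3) *\<^sub>R rotJ (e 1 u) = frame u v"
    unfolding tangent_plane_eq[OF u] using mmul_cancel[OF in_SLSL[OF u]] by blast
  then have "sqrt 3 *\<^sub>R (1 / sqrt 3) *\<^sub>R rotJ (e 1 u) = sqrt 3 *\<^sub>R frame u v" by simp
  then have eq: "rotJ (e 1 u) = (sqrt 3 * v$1) *\<^sub>R e 1 u + (sqrt 3 * v$2) *\<^sub>R e 2 u"
    by (simp add: frame_def scaleR_add_right)
  have "sqrt 3 * v$2 \<noteq> 0"
  proof
    assume "sqrt 3 * v$2 = 0"
    then have r: "rotJ (e 1 u) = (sqrt 3 * v$1) *\<^sub>R e 1 u" using eq by simp
    have "- 3 *\<^sub>R e 1 u = rotJ (rotJ (e 1 u))" by (simp add: rotJ_rotJ)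
    also have "\<dots> = (sqrt 3 * v$1)\<^sup>2 *\<^sub>R e 1 u" unfolding r rotJ_scaleR by (simp add: r power2_eq_square)
    finally have "- 3 = (sqrt 3 * v$1)\<^sup>2"
      using e1_nonzero[OF u] by (metis scaleR_cancel_right)
    then show False by (smt (verit) zero_le_power2)
  qed
  then show ?thesis using that eq by blast
qed

lemma range_frame:
  assumes u: "u \<in> U"
  shows "range (frame u) = {p *\<^sub>R e 1 u + q *\<^sub>R rotJ (e 1 u) | p q. True}"
proof -
  obtain x y where xy: "rotJ (e 1 u) = x *\<^sub>R e 1 u + y *\<^sub>R e 2 u" "y \<noteq> 0" using rotJ_e1[OF u] .
  have 1: "frame u v = (v$1 - v$2 * x / y) *\<^sub>R e 1 u + (v$2 / y) *\<^sub>R rotJ (e 1 u)" for v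
    using xy(2) by (simp add: frame_def xy(1) scaleR_add_right scaleR_diff_left)
  have 2: "p *\<^sub>R e 1 u + q *\<^sub>R rotJ (e 1 u) = frame u (vector [p + q * x, q * y])" for p q
    by (simp add: frame_vector xy(1) algebra_simps)
  show ?thesis
  proof (intro equalityI subsetI)
    fix Z assume "Z \<in> range (frame u)"
    then show "Z \<in> {p *\<^sub>R e 1 u + q *\<^sub>R rotJ (e 1 u) | p q. True}" using 1 by blast
  qed (use 2 in blast)
qed

lemma g0_e1_nonzero:
  assumes u: "u \<in> U"
  shows "g0 (e 1 u) (e 1 u) \<noteq> 0"
proof
  assume 0: "g0 (e 1 u) (e 1 u) = 0"
  have "g0 (e 1 u) (frame u v) = 0" for v
  proof -
    obtain p q where "frame u v = p *\<^sub>R e 1 u + q *\<^sub>R rotJ (e 1 u)" using range_frame[OF u] by blast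
    then show ?thesis by (simp add: g0.add_right g0.scaleR_right 0 g0_rotJ)
  qed
  moreover have "\<phi> u \<odot> e 1 u \<in> tangent_plane \<phi> u" by (rule e1_tangent[OF u])
  ultimately have "\<phi> u \<odot> e 1 u = 0"
    using nondegenerate[OF u, of "\<phi> u \<odot> e 1 u"] in_SLSL[OF u]
    by (auto simp: tangent_plane_eq[OF u] nk_metric_SLSL)
  then show False
    using e1_nonzero[OF u] in_SLSL[OF u] by (metis mmul_cancel mmul.zero_right)
qed

lemma normal_subspace_iff:
  assumes u: "u \<in> U"
  shows "\<phi> u \<odot> n \<in> normal_subspace \<phi> u \<longleftrightarrow> n \<in> sl22 \<and> (\<forall>v. g0 n (frame u v) = 0)"
  using in_SLSL[OF u]
  by (auto simp: normal_subspace_def tangent_plane_eq[OF u] nk_metric_SLSL tangent_SLSL_iff)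

text \<open>The normal part of a tangent vector of \<open>SLSL\<close> exists and is unique, as the induced metric is
  nondegenerate, so that a vanishing value of \<open>normal_part\<close> is informative.\<close>

lemma normal_part_eq_0_imp:
  assumes u: "u \<in> U" and w: "w \<in> sl22" and 0: "normal_part \<phi> u (\<phi> u \<odot> w) = 0"
  shows "w \<in> range (frame u)"
proof -
  let ?X = "e 1 u" and ?Y = "rotJ (e 1 u)" and ?p = "\<phi> u"
  let ?P = "\<lambda>N. N \<in> normal_subspace \<phi> u \<and> ?p \<odot> w - N \<in> tangent_plane \<phi> u"
  have p: "?p \<in> SLSL" by (rule in_SLSL[OF u])
  have g: "g0 ?X ?X \<noteq> 0" by (rule g0_e1_nonzero[OF u])
  define t where "t = (g0 w ?X / g0 ?X ?X) *\<^sub>R ?X + (g0 w ?Y / (3 * g0 ?X ?X)) *\<^sub>R ?Y"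
  have t: "t \<in> range (frame u)" unfolding t_def range_frame[OF u] by blast
  have n: "?p \<odot> (w - t) \<in> normal_subspace \<phi> u"
    unfolding normal_subspace_iff[OF u]
  proof (intro conjI allI)
    show "w - t \<in> sl22" using w t frame_sl22[OF u] subspace_sl22 by (auto intro: subspace_diff)
    fix v
    obtain r s where "frame u v = r *\<^sub>R ?X + s *\<^sub>R ?Y" using range_frame[OF u] by blast
    moreover have "g0 (w - t) ?X = 0" "g0 (w - t) ?Y = 0"
      using g g0_rotJ[of ?X] g0_commute[of ?Y ?X]
      by (simp_all add: t_def g0.diff_left g0.add_left g0.scaleR_left)
    ultimately show "g0 (w - t) (frame u v) = 0" by (simp add: g0.add_right g0.scaleR_right)
  qed
  have "\<exists>!N. ?P N"
  proof (rule ex1I[of _ "?p \<odot> (w - t)"])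
    show "?P (?p \<odot> (w - t))"
      using n t by (simp add: tangent_plane_eq[OF u] flip: mmul.diff_right)
    fix N assume N: "?P N"
    then obtain n where N_eq: "N = ?p \<odot> n" unfolding normal_subspace_def tangent_SLSL_eq by blast
    obtain v where "?p \<odot> (w - n) = ?p \<odot> frame u v"
      using N unfolding N_eq tangent_plane_eq[OF u] mmul.diff_right by auto
    then have v: "w - n = frame u v" by (simp add: mmul_cancel[OF p])
    obtain v' where v': "t = frame u v'" using t by blast
    have "w - t - n = frame u (v - v')" using v v' by (simp add: frame_def algebra_simps)
    then have "?p \<odot> (w - t - n) \<in> tangent_plane \<phi> u" unfolding tangent_plane_eq[OF u] by simp
    moreover have "g0 (w - t - n) (frame u v'') = 0" for v''
      using N n unfolding N_eq normal_subspace_iff[OF u] by (simp add: g0.diff_left)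
    ultimately have "?p \<odot> (w - t - n) = 0"
      using nondegenerate[OF u] p by (auto simp: tangent_plane_eq[OF u] nk_metric_SLSL)
    then show "N = ?p \<odot> (w - t)" unfolding N_eq by (simp add: mmul.diff_right)
  qed
  then have "?P (normal_part \<phi> u (?p \<odot> w))" unfolding normal_part_def by (rule theI')
  then have "?p \<odot> w \<in> tangent_plane \<phi> u" by (simp add: 0)
  then show ?thesis unfolding tangent_plane_eq[OF u] by (auto simp: mmul_cancel[OF p])
qed

lemma D_in_frame:
  assumes u: "u \<in> U"
  shows "D i j u \<in> range (frame u)"
  using geodesic[OF u, of "axis i 1" "axis j 1"] normal_part_eq_0_imp[OF u D_sl22[OF u]]
  by (simp add: second_fundamental_form_def covd_along_phi[OF u])

lemma induced_metric_nth:
  assumes u: "u \<in> U"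
  shows "G u $ i $ j = g0 (e i u) (e j u)"
  using in_SLSL[OF u] by (simp add: induced_metric_def nk_metric_SLSL partial_deriv_phi[OF u])

text \<open>
  The Gram determinants of the bases \<open>e 1, e 2\<close> and \<open>e 1, rotJ (e 1)\<close> differ by the factor \<open>y\<^sup>2\<close>; the
  second basis is orthogonal.
\<close>

lemma det_G:
  assumes u: "u \<in> U" and xy: "rotJ (e 1 u) = x *\<^sub>R e 1 u + y *\<^sub>R e 2 u"
  shows "y\<^sup>2 * det (G u) = 3 * (g0 (e 1 u) (e 1 u))\<^sup>2"
proof -
  let ?g = "g0 (e 1 u) (e 1 u)" and ?h = "g0 (e 1 u) (e 2 u)" and ?k = "g0 (e 2 u) (e 2 u)"
  have 21: "g0 (e 2 u) (e 1 u) = ?h" by (rule g0_commute)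
  have "x * ?g + y * ?h = 0" "x * (x * ?g + y * ?h) + y * (x * ?h + y * ?k) = 3 * ?g"
    using g0_rotJ[of "e 1 u"] unfolding xy
    by (simp_all add: g0.add_left g0.add_right g0.scaleR_left g0.scaleR_right 21)
  then have "y\<^sup>2 * (?g * ?k - ?h * ?h) = 3 * ?g\<^sup>2" by algebra
  then show ?thesis by (simp add: det_2 induced_metric_nth[OF u] 21)
qed

lemma det_G_nonzero:
  assumes u: "u \<in> U"
  shows "det (G u) \<noteq> 0"
proof -
  obtain x y where "rotJ (e 1 u) = x *\<^sub>R e 1 u + y *\<^sub>R e 2 u" using rotJ_e1[OF u] .
  from det_G[OF u this] show ?thesis using g0_e1_nonzero[OF u] by auto
qed

lemma differentiable_D:
  assumes u: "u \<in> U"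
  shows "D i j differentiable (at u)"
  unfolding D_def[abs_def] using differentiable_e[OF u]
  by (intro differentiable_add differentiable_bilinear[OF bounded_bilinear_omega])

lemma differentiable_G:
  assumes u: "u \<in> U"
  shows "(\<lambda>u. G u $ i $ j) differentiable (at u)"
proof (rule differentiable_cong_open[OF open_U u])
  show "(\<lambda>u. g0 (e i u) (e j u)) differentiable (at u)"
    by (rule differentiable_bilinear[OF bounded_bilinear_g0 differentiable_e(1)[OF u] differentiable_e(1)[OF u]])
qed (simp add: induced_metric_nth)

lemma partial_deriv_G:
  assumes u: "u \<in> U"
  shows "partial_deriv k (\<lambda>u'. G u' $ i $ j) u = g0 (D k i u) (e j u) + g0 (e i u) (D k j u)"
proof -
  have "partial_deriv k (\<lambda>u'. G u' $ i $ j) u = partial_deriv k (\<lambda>u'. g0 (e i u') (e j u')) u"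
    by (rule partial_deriv_cong_open[OF open_U u induced_metric_nth differentiable_G[OF u]])
  also have "\<dots> = g0 (partial_deriv k (e i) u) (e j u) + g0 (e i u) (partial_deriv k (e j) u)"
    using differentiable_e(1)[OF u] by (simp add: partial_deriv_bilinear[OF bounded_bilinear_g0])
  also have "\<dots> = g0 (D k i u) (e j u) + g0 (e i u) (D k j u)"
    using omega_metric[of "e k u" "e i u" "e j u"] by (simp add: D_def g0.add_left g0.add_right)
  finally show ?thesis .
qed

text \<open>
  By metric compatibility of \<open>omega\<close> and symmetry of \<open>D\<close>, the combination of derivatives of \<open>G\<close> in the
  definition of the Christoffel symbols is the Koszul expression for \<open>2 g0 (D i j) (e l)\<close>.
\<close>

lemma christoffel_eq:
  assumes u: "u \<in> U"
  shows "christoffel G k i j u = (\<Sum>l\<in>UNIV. matrix_inv (G u) $ k $ l * g0 (D i j u) (e l u))"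
proof -
  have "partial_deriv i (\<lambda>u'. G u' $ j $ l) u + partial_deriv j (\<lambda>u'. G u' $ i $ l) u
      - partial_deriv l (\<lambda>u'. G u' $ i $ j) u = 2 * g0 (D i j u) (e l u)" for l
    using D_symmetric[OF u, of j i] D_symmetric[OF u, of l i] D_symmetric[OF u, of l j]
      g0_commute[of "e j u" "D i l u"]
    by (simp add: partial_deriv_G[OF u] g0_commute[of "e i u"])
  then show ?thesis unfolding christoffel_def by (simp add: sum_2)
qed

lemma christoffel_explicit:
  assumes u: "u \<in> U"
  shows "christoffel G 1 i j u = (1 / det (G u)) *
      (G u $ 2 $ 2 * g0 (D i j u) (e 1 u) - G u $ 1 $ 2 * g0 (D i j u) (e 2 u))"
    and "christoffel G 2 i j u = (1 / det (G u)) *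
      (G u $ 1 $ 1 * g0 (D i j u) (e 2 u) - G u $ 2 $ 1 * g0 (D i j u) (e 1 u))"
  using det_G_nonzero[OF u]
  by (simp_all add: christoffel_eq[OF u] matrix_inv_2 sum_2 field_simps)

text \<open>Total geodesy makes the Christoffel symbols of the induced metric the components of the ambient
  covariant derivative.\<close>

lemma christoffel_expansion:
  assumes u: "u \<in> U"
  shows "D i j u = christoffel G 1 i j u *\<^sub>R e 1 u + christoffel G 2 i j u *\<^sub>R e 2 u"
proof -
  obtain a b where ab: "D i j u = a *\<^sub>R e 1 u + b *\<^sub>R e 2 u"
    using D_in_frame[OF u, of i j] unfolding frame_def by blast
  have g: "g0 (D i j u) (e l u) = a * G u $ 1 $ l + b * G u $ 2 $ l" for l
    by (simp add: ab g0.add_left g0.scaleR_left induced_metric_nth[OF u])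
  have "G u $ 2 $ 1 = G u $ 1 $ 2" by (simp add: induced_metric_nth[OF u] g0_commute)
  then have "christoffel G 1 i j u = a" "christoffel G 2 i j u = b"
    unfolding christoffel_explicit[OF u] g using det_G_nonzero[OF u]
    by (simp_all add: field_simps) (simp_all add: det_2 algebra_simps)
  then show ?thesis using ab by simp
qed

lemma differentiable_christoffel:
  assumes u: "u \<in> U"
  shows "christoffel G k i j differentiable (at u)"
proof -
  have g: "(\<lambda>u. g0 (D i j u) (e l u)) differentiable (at u)" for l
    by (rule differentiable_bilinear[OF bounded_bilinear_g0 differentiable_D[OF u] differentiable_e(1)[OF u]])
  have d: "(\<lambda>u. 1 / det (G u)) differentiable (at u)"
    unfolding det_2 using det_G_nonzero[OF u]
    by (intro differentiable_divide differentiable_diff differentiable_mult differentiable_G[OF u])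
      (auto simp: det_2)
  have "(\<lambda>u. (1 / det (G u)) * (G u $ a $ b * g0 (D i j u) (e l u) - G u $ c $ d * g0 (D i j u) (e m u)))
      differentiable (at u)" for a b c d l m
    by (intro differentiable_mult differentiable_diff d g differentiable_G[OF u])
  note diff = this
  have "christoffel G 1 i j differentiable (at u)"
    by (rule differentiable_cong_open[OF open_U u _ diff]) (rule christoffel_explicit(1)[symmetric])
  moreover have "christoffel G 2 i j differentiable (at u)"
    by (rule differentiable_cong_open[OF open_U u _ diff]) (rule christoffel_explicit(2)[symmetric])
  ultimately show ?thesis using exhaust_2[of k] by auto
qed

text \<open>
  Differentiate the expansion of \<open>\<partial>\<^sub>j (e k)\<close> that total geodesy provides, and use that partial derivatives
  of \<open>e k\<close> commute.  The tangential terms form the Riemann tensor of the induced metric, those with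
  \<open>omega\<close> alone the ambient curvature.
\<close>

lemma Gauss_equation:
  assumes u: "u \<in> U"
  shows "riemann G 1 k 1 2 u *\<^sub>R e 1 u + riemann G 2 k 1 2 u *\<^sub>R e 2 u = Omega (e 1 u) (e 2 u) (e k u)"
proof -
  let ?c = "\<lambda>l i j. christoffel G l i j u" and ?e = "\<lambda>i. e i u" and ?o = omega
  have de: "partial_deriv j (e k) x = christoffel G 1 j k x *\<^sub>R e 1 x + christoffel G 2 j k x *\<^sub>R e 2 x
      - omega (e j x) (e k x)" if "x \<in> U" for x j k
    using christoffel_expansion[OF that, of j k] by (simp add: D_def algebra_simps)
  \<comment> \<open>\<open>A\<close> collects the tangential terms.  The mixed terms \<open>B\<close> enter only as \<open>B i j + B j i\<close>, and thus
    cancel when the two orders of differentiation are compared.\<close>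
  define A where "A i j = partial_deriv i (christoffel G 1 j k) u *\<^sub>R ?e 1
      + partial_deriv i (christoffel G 2 j k) u *\<^sub>R ?e 2
      + ?c 1 j k *\<^sub>R (?c 1 i 1 *\<^sub>R ?e 1 + ?c 2 i 1 *\<^sub>R ?e 2)
      + ?c 2 j k *\<^sub>R (?c 1 i 2 *\<^sub>R ?e 1 + ?c 2 i 2 *\<^sub>R ?e 2)" for i j
  define B where "B i j = ?c 1 j k *\<^sub>R ?o (?e i) (?e 1) + ?c 2 j k *\<^sub>R ?o (?e i) (?e 2)" for i j
  have pp: "partial_deriv i (partial_deriv j (e k)) u
      = A i j - B i j - B j i + ?o (?e j) (?o (?e i) (?e k)) - ?o (partial_deriv i (e j) u) (?e k)" for i j
  proof -
    note dif = differentiable_e[OF u] differentiable_christoffel[OF u]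
      differentiable_bilinear[OF bounded_bilinear_scaleR] differentiable_bilinear[OF bounded_bilinear_omega]
      differentiable_add
    have "partial_deriv i (partial_deriv j (e k)) u = partial_deriv i (\<lambda>x. christoffel G 1 j k x *\<^sub>R e 1 x
        + christoffel G 2 j k x *\<^sub>R e 2 x - omega (e j x) (e k x)) u"
      by (rule partial_deriv_cong_open[OF open_U u de differentiable_e(2)[OF u]])
    also have "\<dots> = (?c 1 j k *\<^sub>R partial_deriv i (e 1) u + partial_deriv i (christoffel G 1 j k) u *\<^sub>R ?e 1)
        + (?c 2 j k *\<^sub>R partial_deriv i (e 2) u + partial_deriv i (christoffel G 2 j k) u *\<^sub>R ?e 2)
        - (?o (?e j) (partial_deriv i (e k) u) + ?o (partial_deriv i (e j) u) (?e k))"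
      by (simp add: partial_deriv_diff partial_deriv_add dif
          partial_deriv_bilinear[OF bounded_bilinear_scaleR] partial_deriv_bilinear[OF bounded_bilinear_omega])
    finally show ?thesis
      unfolding de[OF u, of i 1] de[OF u, of i 2] de[OF u, of i k] A_def B_def
      by (simp add: omega.add_right omega.diff_right omega.scaleR_right algebra_simps)
  qed
  have "partial_deriv 1 (partial_deriv 2 (e k)) u = partial_deriv 2 (partial_deriv 1 (e k)) u"
    by (rule partial_deriv_commute[OF open_U u smooth_e])
  then have "A 1 2 - A 2 1 = ?o (?e 1) (?o (?e 2) (?e k)) - ?o (?e 2) (?o (?e 1) (?e k))
      + ?o (partial_deriv 1 (e 2) u - partial_deriv 2 (e 1) u) (?e k)"
    unfolding pp by (simp add: omega.diff_left algebra_simps)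
  then have "A 1 2 - A 2 1 = Omega (?e 1) (?e 2) (?e k)"
    unfolding Maurer_Cartan[OF u] by (simp add: Omega_def omega.minus_left)
  moreover have "A 1 2 - A 2 1 = riemann G 1 k 1 2 u *\<^sub>R e 1 u + riemann G 2 k 1 2 u *\<^sub>R e 2 u"
    unfolding A_def riemann_def by (simp add: sum_2 algebra_simps)
  ultimately show ?thesis by simp
qed

text \<open>
  Passing from \<open>e 2\<close> to \<open>rotJ (e 1)\<close> multiplies the numerator and the denominator of the curvature by the
  same factor.
\<close>

lemma gaussian_curvature_eq:
  assumes u: "u \<in> U"
  shows "gaussian_curvature \<phi> u = - g0 (Omega (e 1 u) (rotJ (e 1 u)) (e 1 u)) (rotJ (e 1 u))
      / (3 * (g0 (e 1 u) (e 1 u))\<^sup>2)"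
proof -
  let ?R = "Omega (e 1 u) (e 2 u)"
  obtain x y where xy: "rotJ (e 1 u) = x *\<^sub>R e 1 u + y *\<^sub>R e 2 u" "y \<noteq> 0" using rotJ_e1[OF u] .
  have "g0 (?R (e 1 u)) (e 1 u) = 0" using Omega_skew[of "e 1 u" "e 2 u" "e 1 u" "e 1 u"] by simp
  then have num: "g0 (Omega (e 1 u) (rotJ (e 1 u)) (e 1 u)) (rotJ (e 1 u)) = - (y\<^sup>2 * g0 (?R (e 2 u)) (e 1 u))"
    using Omega_skew[of "e 1 u" "e 2 u" "e 1 u" "e 2 u"]
    by (simp add: xy(1) Omega_linear Omega_self g0.add_right g0.scaleR_right g0.scaleR_left power2_eq_square)
  have "gaussian_curvature \<phi> u = (G u $ 1 $ 1 * riemann G 1 2 1 2 u + G u $ 2 $ 1 * riemann G 2 2 1 2 u) / det (G u)"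
    by (simp add: gaussian_curvature_def Let_def sum_2)
  also have "\<dots> = g0 (?R (e 2 u)) (e 1 u) / det (G u)"
    by (simp add: Gauss_equation[OF u, symmetric] g0.add_left g0.scaleR_left induced_metric_nth[OF u] mult.commute)
  also have "\<dots> = (y\<^sup>2 * g0 (?R (e 2 u)) (e 1 u)) / (y\<^sup>2 * det (G u))" using xy(2) by simp
  finally show ?thesis unfolding det_G[OF u xy(1)] num by simp
qed

lemma curvature_in_frame:
  assumes u: "u \<in> U"
  obtains p q where "Omega (e 1 u) (rotJ (e 1 u)) (e 1 u) = p *\<^sub>R e 1 u + q *\<^sub>R rotJ (e 1 u)"
proof -
  obtain x y where xy: "rotJ (e 1 u) = x *\<^sub>R e 1 u + y *\<^sub>R e 2 u" using rotJ_e1[OF u] .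
  have "Omega (e 1 u) (rotJ (e 1 u)) (e 1 u) = y *\<^sub>R Omega (e 1 u) (e 2 u) (e 1 u)"
    by (simp add: xy Omega_linear Omega_self)
  also have "\<dots> = frame u (vector [y * riemann G 1 1 1 2 u, y * riemann G 2 1 1 2 u])"
    by (simp add: Gauss_equation[OF u, symmetric] frame_vector scaleR_add_right)
  finally show ?thesis using that range_frame[OF u] by (smt (verit) mem_Collect_eq rangeI)
qed

end

section \<open>The two types of points\<close>

context totally_geodesic_patch
begin

definition P_normal :: "real^2 \<Rightarrow> bool" where
  "P_normal u \<longleftrightarrow> P_map (\<phi> u) ` tangent_plane \<phi> u \<subseteq> normal_subspace \<phi> u"

definition P_tangent :: "real^2 \<Rightarrow> bool" where
  "P_tangent u \<longleftrightarrow> P_map (\<phi> u) ` tangent_plane \<phi> u = tangent_plane \<phi> u"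

text \<open>
  The quantity whose vanishing distinguishes the two types of points.
\<close>

definition commutator :: "real^2 \<Rightarrow> mat2" where
  "commutator u = com (fst (e 1 u)) (snd (e 1 u))"

text \<open>
  Otherwise the tangent plane would be orthogonal to itself.
\<close>

lemma P_normal_and_P_tangent_exclusive:
  assumes u: "u \<in> U"
  shows "\<not> (P_normal u \<and> P_tangent u)"
proof
  assume "P_normal u \<and> P_tangent u"
  then have sub: "tangent_plane \<phi> u \<subseteq> normal_subspace \<phi> u" unfolding P_normal_def P_tangent_def by blast
  have "\<phi> u \<odot> e 1 u \<in> tangent_plane \<phi> u" by (rule e1_tangent[OF u])
  moreover from this have "\<forall>W\<in>tangent_plane \<phi> u. nk_metric (\<phi> u) (\<phi> u \<odot> e 1 u) W = 0"
    using sub unfolding normal_subspace_def by blast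
  ultimately have "nk_metric (\<phi> u) (\<phi> u \<odot> e 1 u) (\<phi> u \<odot> e 1 u) = 0" by blast
  then show False using in_SLSL[OF u] g0_e1_nonzero[OF u] by (simp add: nk_metric_SLSL)
qed

lemma frame_traces:
  assumes "u \<in> U"
  shows "trace (fst (e 1 u)) = 0" "trace (snd (e 1 u)) = 0"
  using e_sl22[OF assms, of 1] by (simp_all add: sl22_def)

lemma commuting_case:
  assumes u: "u \<in> U" and comm: "commutator u = 0"
  shows "P_tangent u" "gaussian_curvature \<phi> u = 0"
    and "P_map (\<phi> u) ` normal_subspace \<phi> u = normal_subspace \<phi> u"
proof -
  obtain a b where ab: "e 1 u = (a, b)" by (cases "e 1 u")
  have tr: "trace a = 0" "trace b = 0" and com: "com a b = 0"
    using frame_traces[OF u] comm by (simp_all add: ab commutator_def)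
  have p: "\<phi> u \<in> SLSL" by (rule in_SLSL[OF u])
  have sw: "prod.swap (frame u v) \<in> range (frame u)" for v
  proof -
    obtain p q where pq: "frame u v = p *\<^sub>R e 1 u + q *\<^sub>R rotJ (e 1 u)" using range_frame[OF u] by blast
    obtain p1 q1 p2 q2 where "prod.swap (e 1 u) = p1 *\<^sub>R e 1 u + q1 *\<^sub>R rotJ (e 1 u)"
      "prod.swap (rotJ (e 1 u)) = p2 *\<^sub>R e 1 u + q2 *\<^sub>R rotJ (e 1 u)"
      using swap_in_plane[OF tr com] unfolding ab by blast
    then have "prod.swap (frame u v) = (p * p1 + q * p2) *\<^sub>R e 1 u + (p * q1 + q * q2) *\<^sub>R rotJ (e 1 u)"
      unfolding pq swap_add swap_scaleR by (simp add: algebra_simps)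
    then show ?thesis unfolding range_frame[OF u] by blast
  qed
  \<comment> \<open>As \<open>P\<close> is an involution, one inclusion suffices for each of the two equations.\<close>
  have inv: "P_map (\<phi> u) (P_map (\<phi> u) (\<phi> u \<odot> X)) = \<phi> u \<odot> X" for X
    by (simp add: P_map_eq[OF p])
  have T: "P_map (\<phi> u) V \<in> tangent_plane \<phi> u \<and> V = P_map (\<phi> u) (P_map (\<phi> u) V)"
    if "V \<in> tangent_plane \<phi> u" for V
    using that sw inv unfolding tangent_plane_eq[OF u] by (force simp: P_map_eq[OF p])
  then show "P_tangent u" unfolding P_tangent_def by blast
  have N: "P_map (\<phi> u) V \<in> normal_subspace \<phi> u \<and> V = P_map (\<phi> u) (P_map (\<phi> u) V)"
    if V: "V \<in> normal_subspace \<phi> u" for V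
  proof -
    obtain n where n: "V = \<phi> u \<odot> n" using V unfolding normal_subspace_def tangent_SLSL_eq by blast
    have nt: "n \<in> sl22" and nv: "g0 n (frame u v) = 0" for v
      using V unfolding n normal_subspace_iff[OF u] by auto
    have "g0 n (prod.swap (frame u v)) = 0" for v using sw[of v] nv by auto
    then have "prod.swap n \<in> sl22 \<and> (\<forall>v. g0 (prod.swap n) (frame u v) = 0)"
      using nt by (simp add: g0_swap sl22_def)
    then show ?thesis using inv n by (simp add: P_map_eq[OF p] normal_subspace_iff[OF u])
  qed
  then show "P_map (\<phi> u) ` normal_subspace \<phi> u = normal_subspace \<phi> u" by blast
  have "Omega (e 1 u) (rotJ (e 1 u)) (e 1 u) = 0"
    unfolding ab Omega_rotJ com by (simp add: com.zero_right flip: zero_prod_def)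
  then show "gaussian_curvature \<phi> u = 0" by (simp add: gaussian_curvature_eq[OF u] g0.zero_left)
qed

lemma noncommuting_case:
  assumes u: "u \<in> U" and ip: "ip (fst (e 1 u)) (fst (e 1 u)) = 2 * ip (fst (e 1 u)) (snd (e 1 u))"
    "ip (snd (e 1 u)) (snd (e 1 u)) = 2 * ip (fst (e 1 u)) (snd (e 1 u))"
  shows "P_normal u" "gaussian_curvature \<phi> u = - 4/3"
proof -
  obtain a b where ab: "e 1 u = (a, b)" by (cases "e 1 u")
  have tr: "trace a = 0" "trace b = 0" using frame_traces[OF u] by (simp_all add: ab)
  have ip': "ip a a = 2 * ip a b" "ip b b = 2 * ip a b" using ip by (simp_all add: ab)
  have "g0 (prod.swap (frame u v)) (frame u v') = 0" for v v'
  proof -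
    obtain p q where "frame u v = p *\<^sub>R e 1 u + q *\<^sub>R rotJ (e 1 u)" using range_frame[OF u] by blast
    moreover obtain r s where "frame u v' = r *\<^sub>R e 1 u + s *\<^sub>R rotJ (e 1 u)" using range_frame[OF u] by blast
    ultimately show ?thesis unfolding ab using swap_normal_to_plane[OF ip'] by simp
  qed
  moreover have "prod.swap (frame u v) \<in> sl22" for v
    using frame_sl22[OF u, of v] by (simp add: sl22_def)
  ultimately have "P_map (\<phi> u) (\<phi> u \<odot> frame u v) \<in> normal_subspace \<phi> u" for v
    by (simp add: P_map_eq[OF in_SLSL[OF u]] normal_subspace_iff[OF u])
  then show "P_normal u" unfolding P_normal_def tangent_plane_eq[OF u] by blast
  show "gaussian_curvature \<phi> u = - 4/3"
    using plane_curvature[OF tr ip'] g0_e1_nonzero[OF u] by (simp add: gaussian_curvature_eq[OF u] ab)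
qed

lemma dichotomy:
  assumes u: "u \<in> U" and "commutator u \<noteq> 0"
  shows "ip (fst (e 1 u)) (fst (e 1 u)) = 2 * ip (fst (e 1 u)) (snd (e 1 u))"
    "ip (snd (e 1 u)) (snd (e 1 u)) = 2 * ip (fst (e 1 u)) (snd (e 1 u))"
proof -
  obtain p q where pq: "Omega (e 1 u) (rotJ (e 1 u)) (e 1 u) = p *\<^sub>R e 1 u + q *\<^sub>R rotJ (e 1 u)"
    using curvature_in_frame[OF u] .
  show "ip (fst (e 1 u)) (fst (e 1 u)) = 2 * ip (fst (e 1 u)) (snd (e 1 u))"
    "ip (snd (e 1 u)) (snd (e 1 u)) = 2 * ip (fst (e 1 u)) (snd (e 1 u))"
    using curvature_dichotomy[OF frame_traces[OF u]] pq assms(2) by (auto simp: commutator_def)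
qed

lemma P_normal_iff:
  assumes "u \<in> U"
  shows "P_normal u \<longleftrightarrow> commutator u \<noteq> 0"
  using P_normal_and_P_tangent_exclusive commuting_case(1) noncommuting_case(1) dichotomy assms by blast

lemma P_tangent_iff:
  assumes "u \<in> U"
  shows "P_tangent u \<longleftrightarrow> commutator u = 0"
  using P_normal_and_P_tangent_exclusive commuting_case(1) P_normal_iff assms by blast

lemma open_P_normal: "open {u \<in> U. P_normal u}"
proof -
  have "continuous_on U commutator"
    unfolding commutator_def[abs_def] by (intro bounded_bilinear.continuous_on[OF bounded_bilinear_com] continuous_intros
        smooth_on_imp_continuous_on[OF smooth_e])
  then have "open (U \<inter> commutator -` (- {0}))"
    by (rule continuous_open_preimage) (auto simp: open_U)
  moreover have "{u \<in> U. P_normal u} = U \<inter> commutator -` (- {0})" using P_normal_iff by auto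
  ultimately show ?thesis by simp
qed

text \<open>
  Both types of points are given by the non-vanishing of a continuous function: \<open>P_normal\<close> by that of the
  commutator, and \<open>P_tangent\<close> by that of the relations of the noncommuting case.
\<close>

lemma open_P_tangent: "open {u \<in> U. P_tangent u}"
proof -
  let ?f = "\<lambda>u. (ip (fst (e 1 u)) (fst (e 1 u)) - 2 * ip (fst (e 1 u)) (snd (e 1 u)),
    ip (snd (e 1 u)) (snd (e 1 u)) - 2 * ip (fst (e 1 u)) (snd (e 1 u)))"
  have "continuous_on U ?f"
    by (intro bounded_bilinear.continuous_on[OF bounded_bilinear_ip] continuous_intros
        smooth_on_imp_continuous_on[OF smooth_e])
  then have "open (U \<inter> ?f -` (- {0}))"
    by (rule continuous_open_preimage) (auto simp: open_U)
  moreover have "{u \<in> U. P_tangent u} = U \<inter> ?f -` (- {0})"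
  proof -
    have "P_tangent u \<longleftrightarrow> ?f u \<noteq> 0" if u: "u \<in> U" for u
    proof
      assume "P_tangent u"
      then have "\<not> P_normal u" using P_normal_and_P_tangent_exclusive[OF u] by blast
      then show "?f u \<noteq> 0" using noncommuting_case(1)[OF u] by (auto simp: zero_prod_def)
    next
      assume "?f u \<noteq> 0"
      then have "commutator u = 0" using dichotomy[OF u] by (auto simp: zero_prod_def)
      then show "P_tangent u" by (rule commuting_case(1)[OF u])
    qed
    then show ?thesis by auto
  qed
  ultimately show ?thesis by simp
qed

end

section \<open>Independence of the chart and connectedness\<close>

lemma smooth_surface_charts:
  assumes "smooth_surface M \<A>" "(U, x) \<in> \<A>"
  shows "open U" "openin M (x ` U)" "homeomorphic_map (top_of_set U) (subtopology M (x ` U)) x"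
  using assms unfolding smooth_surface_def by auto

lemma chart_image_open:
  assumes M: "smooth_surface M \<A>" and x: "(U, x) \<in> \<A>" and S: "open S" "S \<subseteq> U"
  shows "openin M (x ` S)"
proof -
  have "openin (top_of_set U) S" using S by (metis inf.absorb_iff2 openin_open)
  then have "openin (subtopology M (x ` U)) (x ` S)"
    using homeomorphic_map_openness_eq[OF smooth_surface_charts(3)[OF M x]] by blast
  then show ?thesis using smooth_surface_charts(2)[OF M x] openin_trans_full by blast
qed

text \<open>
  The chain rule for the transition map between the two charts, which is defined on the open set \<open>W\<close>.
\<close>

lemma tangent_plane_chart_subset:
  assumes "immersed_surface M \<A> F" and x: "(U, x) \<in> \<A>" and y: "(V, y) \<in> \<A>"
    and u: "u \<in> U" and v: "v \<in> V" and eq: "x u = y v"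
  shows "tangent_plane (F \<circ> x) u \<subseteq> tangent_plane (F \<circ> y) v"
proof -
  have M: "smooth_surface M \<A>" and Fy: "smooth_on V (F \<circ> y)"
    using assms(1) y unfolding immersed_surface_def by auto
  define \<tau> where "\<tau> = inv_into V y \<circ> x"
  define W where "W = {u \<in> U. x u \<in> y ` V}"
  have smooth: "smooth_on W \<tau>" using M x y unfolding smooth_surface_def W_def \<tau>_def by blast
  have "inj_on y V"
    using homeomorphic_imp_injective_map[OF smooth_surface_charts(3)[OF M y]] by simp
  then have \<tau>u: "\<tau> u = v" using v eq by (simp add: \<tau>_def)
  have uW: "u \<in> W" using u v eq by (auto simp: W_def)
  have "openin (subtopology M (x ` U)) (x ` U \<inter> y ` V)"
    using smooth_surface_charts(2)[OF M y] by (metis Int_commute openin_subtopology)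
  then have "openin (top_of_set U) {u \<in> topspace (top_of_set U). x u \<in> x ` U \<inter> y ` V}"
    using homeomorphic_imp_continuous_map[OF smooth_surface_charts(3)[OF M x]]
    by (rule openin_continuous_map_preimage[rotated])
  moreover have "{u \<in> topspace (top_of_set U). x u \<in> x ` U \<inter> y ` V} = W" by (auto simp: W_def)
  ultimately have "open W" using smooth_surface_charts(1)[OF M x] by (metis openin_open_eq)
  have d\<tau>: "(\<tau> has_derivative frechet_derivative \<tau> (at u)) (at u)"
    using smooth_on_imp_differentiable[OF smooth uW] by (simp add: frechet_derivative_works)
  have "(F \<circ> y has_derivative frechet_derivative (F \<circ> y) (at v)) (at (\<tau> u))"
    unfolding \<tau>u using smooth_on_imp_differentiable[OF Fy v] by (simp add: frechet_derivative_works)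
  from diff_chain_at[OF d\<tau> this]
  have "((F \<circ> y) \<circ> \<tau> has_derivative frechet_derivative (F \<circ> y) (at v) \<circ> frechet_derivative \<tau> (at u)) (at u)" .
  moreover have "((F \<circ> y) \<circ> \<tau>) u' = (F \<circ> x) u'" if "u' \<in> W" for u'
    using that by (auto simp: W_def \<tau>_def f_inv_into_f)
  ultimately have "(F \<circ> x has_derivative frechet_derivative (F \<circ> y) (at v) \<circ> frechet_derivative \<tau> (at u)) (at u)"
    using has_derivative_transform_within_open[OF _ \<open>open W\<close> uW] by blast
  then have "frechet_derivative (F \<circ> x) (at u) = frechet_derivative (F \<circ> y) (at v) \<circ> frechet_derivative \<tau> (at u)"
    using frechet_derivative_at by metis
  then show ?thesis unfolding tangent_plane_def by auto
qed

lemma tangent_plane_chart_independent: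
  assumes "immersed_surface M \<A> F" "(U, x) \<in> \<A>" "(V, y) \<in> \<A>" "u \<in> U" "v \<in> V" "x u = y v"
  shows "tangent_plane (F \<circ> x) u = tangent_plane (F \<circ> y) v"
  using tangent_plane_chart_subset[of M \<A> F] assms by (metis subset_antisym)

lemma totally_geodesic_patch_chart:
  assumes "almost_complex_surface M \<A> F" "totally_geodesic \<A> F" "(U, x) \<in> \<A>"
  shows "totally_geodesic_patch U (F \<circ> x)"
proof
  have imm: "immersed_surface M \<A> F" using assms(1) unfolding almost_complex_surface_def by blast
  then have M: "smooth_surface M \<A>" "F ` topspace M \<subseteq> SLSL" unfolding immersed_surface_def by auto
  show "open U" by (rule smooth_surface_charts[OF M(1) assms(3)])
  show "smooth_on U (F \<circ> x)" using imm assms(3) unfolding immersed_surface_def by blast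
  fix u assume u: "u \<in> U"
  have "x u \<in> topspace M" using M(1) assms(3) u unfolding smooth_surface_def by blast
  then show "(F \<circ> x) u \<in> SLSL" using M(2) by auto
  show "inj (frechet_derivative (F \<circ> x) (at u))" using imm assms(3) u unfolding immersed_surface_def by blast
  show "J_map ((F \<circ> x) u) ` tangent_plane (F \<circ> x) u \<subseteq> tangent_plane (F \<circ> x) u"
    using assms(1,3) u unfolding almost_complex_surface_def comp_def by blast
  show "V = 0" if "V \<in> tangent_plane (F \<circ> x) u" "\<forall>W\<in>tangent_plane (F \<circ> x) u. nk_metric ((F \<circ> x) u) V W = 0" for V
    using that assms(1,3) u unfolding almost_complex_surface_def by auto
  show "second_fundamental_form (F \<circ> x) u a b = 0" for a b
    using assms(2,3) u unfolding totally_geodesic_def by blast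
qed

theorem proposition4p1:
  fixes M :: "'m topology" and \<A> :: "'m atlas" and F :: "'m \<Rightarrow> mat22"
  assumes "almost_complex_surface M \<A> F"
    and "totally_geodesic \<A> F"
  shows "(\<forall>(U, x)\<in>\<A>. \<forall>u\<in>U.
            P_map (F (x u)) ` tangent_plane (F \<circ> x) u \<subseteq> normal_subspace (F \<circ> x) u \<and>
            gaussian_curvature (F \<circ> x) u = - 4/3)
       \<or> (\<forall>(U, x)\<in>\<A>. \<forall>u\<in>U.
            P_map (F (x u)) ` tangent_plane (F \<circ> x) u = tangent_plane (F \<circ> x) u \<and>
            P_map (F (x u)) ` normal_subspace (F \<circ> x) u = normal_subspace (F \<circ> x) u \<and>
            gaussian_curvature (F \<circ> x) u = 0)"
proof -
  have imm: "immersed_surface M \<A> F" and conn: "connected_space M"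
    using assms(1) unfolding almost_complex_surface_def by auto
  then have M: "smooth_surface M \<A>" unfolding immersed_surface_def by blast
  note patch = totally_geodesic_patch_chart[OF assms]
  define N where "N x = totally_geodesic_patch.P_normal (F \<circ> x)" for x
  define T where "T x = totally_geodesic_patch.P_tangent (F \<circ> x)" for x
  define MN where "MN = (\<Union>(U, x)\<in>\<A>. x ` {u \<in> U. N x u})"
  define MT where "MT = (\<Union>(U, x)\<in>\<A>. x ` {u \<in> U. T x u})"
  have N_or_T: "N x u \<or> T x u" "\<not> (N x u \<and> T x u)" if "(U, x) \<in> \<A>" "u \<in> U" for U x u
    using totally_geodesic_patch.P_normal_iff[OF patch[OF that(1)] that(2)]
      totally_geodesic_patch.P_tangent_iff[OF patch[OF that(1)] that(2)]
    unfolding N_def T_def by auto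
  have "openin M (x ` {u \<in> U. N x u})" "openin M (x ` {u \<in> U. T x u})" if "(U, x) \<in> \<A>" for U x
    using totally_geodesic_patch.open_P_normal[OF patch[OF that]]
      totally_geodesic_patch.open_P_tangent[OF patch[OF that]]
    unfolding N_def T_def by (auto intro!: chart_image_open[OF M that])
  then have "openin M MN" "openin M MT" unfolding MN_def MT_def by (auto intro!: openin_Union)
  moreover have "topspace M \<subseteq> MN \<union> MT"
    using M N_or_T(1) unfolding smooth_surface_def MN_def MT_def by fastforce
  moreover have "MN \<inter> MT = {}"
  proof -
    have False if x: "(U, x) \<in> \<A>" "u \<in> U" "N x u" and y: "(V, y) \<in> \<A>" "v \<in> V" "T y v" and eq: "x u = y v"
      for U x u V y v
    proof -
      have "tangent_plane (F \<circ> x) u = tangent_plane (F \<circ> y) v"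
        by (rule tangent_plane_chart_independent[OF imm x(1) y(1) x(2) y(2) eq])
      then have "T x u"
        using y(3) eq unfolding T_def totally_geodesic_patch.P_tangent_def[OF patch[OF x(1)]]
          totally_geodesic_patch.P_tangent_def[OF patch[OF y(1)]] by simp
      then show False using N_or_T(2)[OF x(1,2)] x(3) by blast
    qed
    then show ?thesis unfolding MN_def MT_def by fastforce
  qed
  ultimately have "MN = {} \<or> MT = {}" using conn unfolding connected_space_def by blast
  then show ?thesis
  proof
    assume "MT = {}"
    then have N: "N x u" if "(U, x) \<in> \<A>" "u \<in> U" for U x u
      using N_or_T(1)[OF that] that unfolding MT_def by blast
    have "P_map (F (x u)) ` tangent_plane (F \<circ> x) u \<subseteq> normal_subspace (F \<circ> x) u \<and>
        gaussian_curvature (F \<circ> x) u = - 4/3" if x: "(U, x) \<in> \<A>" and u: "u \<in> U" for U x u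
    proof -
      interpret totally_geodesic_patch U "F \<circ> x" by (rule patch[OF x])
      have "P_normal u" using N[OF x u] by (simp add: N_def)
      then have "commutator u \<noteq> 0" using P_normal_iff[OF u] by blast
      then show ?thesis
        using noncommuting_case[OF u dichotomy[OF u]] unfolding P_normal_def by simp
    qed
    then show ?thesis by blast
  next
    assume "MN = {}"
    then have T: "T x u" if "(U, x) \<in> \<A>" "u \<in> U" for U x u
      using N_or_T(1)[OF that] that unfolding MN_def by blast
    have "P_map (F (x u)) ` tangent_plane (F \<circ> x) u = tangent_plane (F \<circ> x) u \<and>
        P_map (F (x u)) ` normal_subspace (F \<circ> x) u = normal_subspace (F \<circ> x) u \<and>
        gaussian_curvature (F \<circ> x) u = 0" if x: "(U, x) \<in> \<A>" and u: "u \<in> U" for U x u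
    proof -
      interpret totally_geodesic_patch U "F \<circ> x" by (rule patch[OF x])
      have "P_tangent u" using T[OF x u] by (simp add: T_def)
      then have "commutator u = 0" using P_tangent_iff[OF u] by blast
      then show ?thesis using commuting_case[OF u] unfolding P_tangent_def by simp
    qed
    then show ?thesis by blast
  qed
qed

end
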